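(* Let $G$ be a finite group and $K$ a field whose characteristic does not divide $|G|$, and let $V$ be a finite-dimensional representation of $G$ over $K$. Let $\{f_1,f_2,\dots,f_r\}$ be a minimal set of homogeneous generators of the invariant ring $K[V]^G$ and let $$J=\{h\in K[x_1,\dots,x_r]\mid h(f_1,f_2,\dots,f_r)=0\}\subseteq K[x_1,\dots,x_r]$$ be the syzygy ideal, where $K[x_1,\dots,x_r]$ is graded by $\deg(x_i)=\deg(f_i)$. Then the ideal $J$ is generated in degree at most $$2\tau_G(V)\leq 2|G| .$$
   Context: $K[V]$ is the coordinate ring of $V$ with its standard grading (a polynomial ring in $\dim V$ variables of degree 1), on which $G$ acts, and $K[V]^G$ is the graded subring of invariants. "Minimal set of homogeneous generators" means a minimal set of homogeneous (positive degree) $K$-algebra generators. Let $I\subseteq K[V]$ be the ideal of $K[V]$ generated by all homogeneous invariants of positive degree. $\tau_G(V)$ is defined as the smallest nonnegative integer $d$ such that every homogeneous polynomial in $K[V]$ of degree $d$ lies in $I$. "$J$ is generated in degree at most $d$" means that $J$ is generated as an ideal by elements that are homogeneous of degree at most $d$ with respect to the grading $\deg(x_i)=\deg(f_i)$. *)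

theory Defs
  imports
    "HOL-Library.Poly_Mapping"
    "HOL-Algebra.Coset"
    "HOL-Algebra.Ideal"
    "HOL-Algebra.Generated_Rings"
begin

section \<open>Polynomial rings\<close>

text \<open>
  A polynomial maps exponent vectors to coefficients, both with finite support; the
  multiplication of \<^typ>\<open>('x \<Rightarrow>\<^sub>0 nat) \<Rightarrow>\<^sub>0 'k\<close> is convolution. The ring
  \<open>mpoly_ring X\<close> consists of the polynomials that involve only variables from \<open>X\<close>.
\<close>

type_synonym ('x, 'k) mpoly = "('x \<Rightarrow>\<^sub>0 nat) \<Rightarrow>\<^sub>0 'k"

definition Const :: "'k::zero \<Rightarrow> ('x, 'k) mpoly"
  where "Const c = Poly_Mapping.single 0 c"

definition Var :: "'x \<Rightarrow> ('x, 'k::zero_neq_one) mpoly"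
  where "Var x = Poly_Mapping.single (Poly_Mapping.single x 1) 1"

definition mpoly_ring :: "'x set \<Rightarrow> ('x, 'k::field) mpoly ring"
  where "mpoly_ring X =
    \<lparr>carrier = {p. \<forall>m \<in> Poly_Mapping.keys p. Poly_Mapping.keys m \<subseteq> X},
     monoid.mult = (*), one = 1, zero = 0, add = (+)\<rparr>"

lemma cring_mpoly_ring: "cring (mpoly_ring (X :: 'x set) :: ('x, 'k::field) mpoly ring)" (is "cring ?R")
proof -
  have mult: "p * q \<in> carrier (?R)"
    if pq: "p \<in> carrier (?R)" "q \<in> carrier (?R)" for p q :: "('x, 'k) mpoly"
  proof -
    have "Poly_Mapping.keys m \<subseteq> X" if m: "m \<in> Poly_Mapping.keys (p * q)" for m
    proof -
      obtain a b where "m = a + b" "a \<in> Poly_Mapping.keys p" "b \<in> Poly_Mapping.keys q"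
        using keys_mult[of p q] m by blast
      moreover from this have "Poly_Mapping.keys a \<subseteq> X" "Poly_Mapping.keys b \<subseteq> X"
        using pq by (simp_all add: mpoly_ring_def)
      ultimately show ?thesis
        using Poly_Mapping.keys_add[of a b] by blast
    qed
    then show ?thesis
      by (simp add: mpoly_ring_def)
  qed
  have add: "p + q \<in> carrier (?R)"
    if "p \<in> carrier (?R)" "q \<in> carrier (?R)" for p q :: "('x, 'k) mpoly"
    using that Poly_Mapping.keys_add[of p q] unfolding mpoly_ring_def by auto
  have neg: "- p \<in> carrier (?R)"
    if "p \<in> carrier (?R)" for p :: "('x, 'k) mpoly"
    using that unfolding mpoly_ring_def by simp
  have ops: "(\<otimes>\<^bsub>?R\<^esub>) = (*)" "(\<oplus>\<^bsub>?R\<^esub>) = (+)"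
    "\<one>\<^bsub>?R\<^esub> = 1" "\<zero>\<^bsub>?R\<^esub> = 0"
    by (simp_all add: mpoly_ring_def)
  have const: "0 \<in> carrier (?R)" "1 \<in> carrier (?R)"
    by (simp_all add: mpoly_ring_def)
  have "abelian_group (?R)"
  proof (rule abelian_groupI, unfold ops)
    fix p q s :: "('x, 'k) mpoly"
    show "p + q + s = p + (q + s)" by (rule add.assoc)
    show "p + q = q + p" by (rule add.commute)
    show "0 + p = p" by (rule add_0_left)
    assume "p \<in> carrier (?R)"
    then show "\<exists>q \<in> carrier (?R). q + p = 0"
      by (intro bexI[of _ "- p"] left_minus neg)
  qed (fact add const)+
  moreover have "comm_monoid (?R)"
  proof (rule comm_monoidI, unfold ops)
    fix p q s :: "('x, 'k) mpoly"
    show "p * q * s = p * (q * s)" by (rule mult.assoc)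
    show "p * q = q * p" by (rule mult.commute)
    show "1 * p = p" by (rule mult_1_left)
  qed (fact mult const)+
  ultimately show ?thesis
    by (rule cringI, unfold ops) (rule distrib_right)
qed

text \<open>\<open>eval_mpoly f p\<close> is \<open>p\<close> with the polynomial \<open>f x\<close> substituted for every variable \<open>x\<close>.\<close>

definition eval_mpoly :: "('x \<Rightarrow> ('y, 'k::field) mpoly) \<Rightarrow> ('x, 'k) mpoly \<Rightarrow> ('y, 'k) mpoly"
  where "eval_mpoly f p =
    (\<Sum>m \<in> Poly_Mapping.keys p.
       Const (Poly_Mapping.lookup p m) * (\<Prod>x \<in> Poly_Mapping.keys m. f x ^ Poly_Mapping.lookup m x))"

text \<open>Gradings: the variable \<open>x\<close> has degree \<open>w x\<close>. The zero polynomial is homogeneous of every degree.\<close>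

definition monom_degree :: "('x \<Rightarrow> nat) \<Rightarrow> ('x \<Rightarrow>\<^sub>0 nat) \<Rightarrow> nat"
  where "monom_degree w m = (\<Sum>x \<in> Poly_Mapping.keys m. w x * Poly_Mapping.lookup m x)"

definition homogeneous :: "('x \<Rightarrow> nat) \<Rightarrow> nat \<Rightarrow> ('x, 'k::zero) mpoly \<Rightarrow> bool"
  where "homogeneous w d p \<longleftrightarrow> (\<forall>m \<in> Poly_Mapping.keys p. monom_degree w m = d)"

abbreviation std_grading :: "'x \<Rightarrow> nat"
  where "std_grading \<equiv> (\<lambda>_. 1)"

definition mpoly_degree :: "('x \<Rightarrow> nat) \<Rightarrow> ('x, 'k::zero) mpoly \<Rightarrow> nat"
  where "mpoly_degree w p = Max (insert 0 (monom_degree w ` Poly_Mapping.keys p))"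

definition generated_in_degree_at_most ::
    "'x set \<Rightarrow> ('x \<Rightarrow> nat) \<Rightarrow> ('x, 'k::field) mpoly set \<Rightarrow> nat \<Rightarrow> bool"
  where "generated_in_degree_at_most X w J N \<longleftrightarrow>
    (\<exists>S \<subseteq> carrier (mpoly_ring X).
       (\<forall>h \<in> S. \<exists>d \<le> N. homogeneous w d h) \<and> J = Idl\<^bsub>mpoly_ring X\<^esub> S)"


section \<open>Representations and invariants\<close>

text \<open>
  The vector space \<open>V\<close> is a type with scalar multiplication \<open>scale\<close> and a finite basis
  \<open>Basis\<close>, possibly empty. Choosing the basis identifies \<open>K[V]\<close> with \<open>mpoly_ring Basis\<close>,
  the variable \<open>b\<close> being the coordinate function dual to the basis vector \<open>b\<close>.
\<close>

locale finite_dim_representation =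
  group G + finite_dimensional_vector_space scale Basis
  for G :: "('g, 'm) monoid_scheme" (structure)
    and scale :: "'k::field \<Rightarrow> 'v::ab_group_add \<Rightarrow> 'v"
    and Basis :: "'v set" +
  fixes \<rho> :: "'g \<Rightarrow> 'v \<Rightarrow> 'v"
  assumes \<rho>_linear: "g \<in> carrier G \<Longrightarrow> Vector_Spaces.linear scale scale (\<rho> g)"
    and \<rho>_one: "\<rho> \<one> v = v"
    and \<rho>_mult: "\<lbrakk>g \<in> carrier G; h \<in> carrier G\<rbrakk> \<Longrightarrow> \<rho> (g \<otimes> h) v = \<rho> g (\<rho> h v)"

text \<open>
  The group acts on \<open>K[V]\<close> by algebra automorphisms with \<open>(g p)(v) = p(g\<inverse> v)\<close>. So \<open>g\<close> sends the
  variable \<open>b\<close> to the linear form whose coefficient at the variable \<open>c\<close> is the \<open>b\<close>-coordinate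
  of \<open>g\<inverse> c\<close>.
\<close>

definition poly_action ::
    "('g, 'm) monoid_scheme \<Rightarrow> ('k::field \<Rightarrow> 'v::ab_group_add \<Rightarrow> 'v) \<Rightarrow> 'v set \<Rightarrow> ('g \<Rightarrow> 'v \<Rightarrow> 'v)
      \<Rightarrow> 'g \<Rightarrow> ('v, 'k) mpoly \<Rightarrow> ('v, 'k) mpoly"
  where "poly_action G scale Basis \<rho> g =
    eval_mpoly (\<lambda>b. \<Sum>c \<in> Basis.
      Const (module.representation scale Basis (\<rho> (inv\<^bsub>G\<^esub> g) c) b) * Var c)"

definition invariants ::
    "('g, 'm) monoid_scheme \<Rightarrow> ('k::field \<Rightarrow> 'v::ab_group_add \<Rightarrow> 'v) \<Rightarrow> 'v set \<Rightarrow> ('g \<Rightarrow> 'v \<Rightarrow> 'v)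
      \<Rightarrow> ('v, 'k) mpoly set"
  where "invariants G scale Basis \<rho> =
    {p \<in> carrier (mpoly_ring Basis). \<forall>g \<in> carrier G. poly_action G scale Basis \<rho> g p = p}"

definition hilbert_ideal ::
    "('g, 'm) monoid_scheme \<Rightarrow> ('k::field \<Rightarrow> 'v::ab_group_add \<Rightarrow> 'v) \<Rightarrow> 'v set \<Rightarrow> ('g \<Rightarrow> 'v \<Rightarrow> 'v)
      \<Rightarrow> ('v, 'k) mpoly set"
  where "hilbert_ideal G scale Basis \<rho> =
    Idl\<^bsub>mpoly_ring Basis\<^esub> {p \<in> invariants G scale Basis \<rho>. \<exists>d>0. homogeneous std_grading d p}"

definition tau ::
    "('g, 'm) monoid_scheme \<Rightarrow> ('k::field \<Rightarrow> 'v::ab_group_add \<Rightarrow> 'v) \<Rightarrow> 'v set \<Rightarrow> ('g \<Rightarrow> 'v \<Rightarrow> 'v) \<Rightarrow> nat"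
  where "tau G scale Basis \<rho> =
    (LEAST d. \<forall>p \<in> carrier (mpoly_ring Basis).
       homogeneous std_grading d p \<longrightarrow> p \<in> hilbert_ideal G scale Basis \<rho>)"

text \<open>The \<open>K\<close>-subalgebra generated by \<open>S\<close> is the subring generated by \<open>S\<close> and the constants.\<close>

definition generates_algebra :: "'x set \<Rightarrow> ('x, 'k::field) mpoly set \<Rightarrow> ('x, 'k) mpoly set \<Rightarrow> bool"
  where "generates_algebra X S A \<longleftrightarrow> generate_ring (mpoly_ring X) (range Const \<union> S) = A"

definition minimal_homogeneous_generators ::
    "'x set \<Rightarrow> ('x, 'k::field) mpoly set \<Rightarrow> ('x, 'k) mpoly set \<Rightarrow> bool"
  where "minimal_homogeneous_generators X S A \<longleftrightarrow>
    (\<forall>p \<in> S. \<exists>d>0. homogeneous std_grading d p) \<and>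
    generates_algebra X S A \<and>
    (\<forall>T. T \<subset> S \<longrightarrow> \<not> generates_algebra X T A)"

definition syzygy_ideal :: "nat \<Rightarrow> (nat \<Rightarrow> ('x, 'k::field) mpoly) \<Rightarrow> (nat, 'k) mpoly set"
  where "syzygy_ideal r f = {h \<in> carrier (mpoly_ring {1..r}). eval_mpoly f h = 0}"

end

theory Submission
  imports Defs
begin

text \<open>
  Write \<open>S = K[V]\<close>, \<open>d\<^sub>i = deg f\<^sub>i\<close> and \<open>\<tau> = \<tau>\<^sub>G(V)\<close>. By Nakayama's lemma for graded modules it
  suffices to show that every homogeneous relation \<open>h\<close> of degree \<open>e > 2\<tau>\<close> lies in
  \<open>(x\<^sub>1, \<dots>, x\<^sub>r) J\<close>. Write \<open>h = \<Sum> x\<^sub>i h\<^sub>i\<close>. Then \<open>w\<^sub>i = h\<^sub>i(f)\<close> is a syzygy \<open>\<Sum> w\<^sub>i f\<^sub>i = 0\<close> with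
  invariant coefficients. If it is a Koszul syzygy, \<open>w\<^sub>i = \<Sum>\<^sub>j a\<^sub>i\<^sub>j f\<^sub>j\<close> with \<open>a\<close> alternating, then
  the Reynolds operator makes the \<open>a\<^sub>i\<^sub>j\<close> invariant, \<open>a\<^sub>i\<^sub>j = A\<^sub>i\<^sub>j(f)\<close>, and
  \<open>h = \<Sum> x\<^sub>i (h\<^sub>i - \<Sum>\<^sub>j A\<^sub>i\<^sub>j x\<^sub>j)\<close>, because the alternating part contributes zero; the expressions in
  parentheses are relations. This is \<open>syzygy_ideal_high_degree\<close>.

  That all syzygies of degree above \<open>2\<tau>\<close> over \<open>S\<close> are Koszul (\<open>syzygy_imp_koszul\<close>) has two
  reasons. First, the syzygies of degree above \<open>\<tau> + 1\<close> are generated by those of degree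
  \<open>\<tau> + 1\<close> (\<open>syzygy_decomposition\<close>): the Koszul complex of the variables is exact and the
  Hilbert ideal \<open>I\<close> contains everything of degree at least \<open>\<tau>\<close>. So a syzygy of degree above \<open>2\<tau>\<close>
  is a combination of syzygies with coefficients of degree at least \<open>\<tau>\<close>, that is, with
  coefficients in \<open>I\<close>. Second, \<open>I\<close> multiplies every syzygy into the Koszul syzygies
  (\<open>koszul_generator_mult\<close>).

  The first reason uses \<open>d\<^sub>i \<le> \<tau>\<close>. If \<open>f\<close> is a homogeneous invariant of positive degree, then
  \<open>f = \<Sum> c\<^sub>i f\<^sub>i\<close> where only generators of degree at most \<open>\<tau>\<close> occur, since these already generate
  all forms of degree \<open>\<tau>\<close>. After the Reynolds operator the \<open>c\<^sub>i\<close> are invariants of smaller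
  degree, and by induction the generators of degree at most \<open>\<tau>\<close> generate the invariant ring; by
  minimality there are no others (\<open>low_eq\<close>).

  Finally \<open>\<tau> \<le> |G|\<close> is an argument of Benson (\<open>prod_linear_forms_in_hilb\<close>): for linear forms
  \<open>y\<^sub>g\<close> indexed by \<open>G\<close>, the sum over \<open>h \<in> G\<close> of the vanishing products
  \<open>\<Prod>\<^sub>g (y\<^sub>g - h g y\<^sub>g)\<close> expands to \<open>|G| \<Prod>\<^sub>g y\<^sub>g\<close> plus elements of the Hilbert ideal.
\<close>

section \<open>Polynomials and substitution\<close>

abbreviation polys :: "'x set \<Rightarrow> ('x, 'k::field) mpoly set"
  where "polys X \<equiv> carrier (mpoly_ring X)"

lemma mem_polys: "p \<in> polys X \<longleftrightarrow> (\<forall>m \<in> Poly_Mapping.keys p. Poly_Mapping.keys m \<subseteq> X)"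
  by (simp add: mpoly_ring_def)

lemma mpoly_ring_ops [simp]:
  "(\<otimes>\<^bsub>mpoly_ring X\<^esub>) = (*)" "(\<oplus>\<^bsub>mpoly_ring X\<^esub>) = (+)"
  "\<one>\<^bsub>mpoly_ring X\<^esub> = 1" "\<zero>\<^bsub>mpoly_ring X\<^esub> = 0"
  by (simp_all add: mpoly_ring_def)

lemma polys_0 [simp]: "0 \<in> polys X" and polys_1 [simp]: "1 \<in> polys X"
  by (simp_all add: mem_polys)

lemma polys_Const [simp]: "Const c \<in> polys X"
  by (simp add: mem_polys Const_def)

lemma polys_Var [simp]: "(Var x :: ('x, 'k::field) mpoly) \<in> polys X \<longleftrightarrow> x \<in> X"
  by (simp add: mem_polys Var_def)

lemma polys_single: "Poly_Mapping.keys m \<subseteq> X \<Longrightarrow> Poly_Mapping.single m c \<in> polys X"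
  by (simp add: mem_polys)

lemma polys_add [simp]: "p \<in> polys X \<Longrightarrow> q \<in> polys X \<Longrightarrow> p + q \<in> polys X"
  and polys_mult [simp]: "p \<in> polys X \<Longrightarrow> q \<in> polys X \<Longrightarrow> p * q \<in> polys X"
  using cring.cring_simprules(1,5)[OF cring_mpoly_ring, of p X q] by simp_all

lemma polys_uminus [simp]: "- p \<in> polys X \<longleftrightarrow> p \<in> polys X"
  by (simp add: mem_polys)

lemma polys_diff [simp]: "p \<in> polys X \<Longrightarrow> q \<in> polys X \<Longrightarrow> p - q \<in> polys X"
  using polys_add[of p X "- q"] by simp

lemma polys_sum [simp]: "(\<And>i. i \<in> A \<Longrightarrow> p i \<in> polys X) \<Longrightarrow> sum p A \<in> polys X"
  by (induction A rule: infinite_finite_induct) auto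

lemma polys_prod [simp]: "(\<And>i. i \<in> A \<Longrightarrow> p i \<in> polys X) \<Longrightarrow> prod p A \<in> polys X"
  by (induction A rule: infinite_finite_induct) auto

lemma polys_power [simp]: "p \<in> polys X \<Longrightarrow> p ^ n \<in> polys X"
  by (induction n) auto

lemma polys_mono: "p \<in> polys X \<Longrightarrow> X \<subseteq> Y \<Longrightarrow> p \<in> polys Y"
  by (force simp: mem_polys)

lemma Const_0 [simp]: "Const 0 = 0" and Const_1 [simp]: "Const 1 = 1"
  by (simp_all add: Const_def)

lemma Const_add: "Const (a + b) = Const a + Const b"
  by (simp add: Const_def single_add)

lemma Const_mult: "Const (a * b) = Const a * Const b"
  by (simp add: Const_def mult_single)

lemma Const_sum: "Const (sum a A) = (\<Sum>i\<in>A. Const (a i))"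
  by (induction A rule: infinite_finite_induct) (auto simp: Const_add)

lemma Const_uminus: "Const (- a) = - Const a"
  by (simp add: Const_def single_uminus)

lemma Const_of_nat: "Const (of_nat n) = of_nat n"
  by (simp add: Const_def)

lemma poly_mapping_sum_monomials:
  assumes "finite A" "Poly_Mapping.keys p \<subseteq> A"
  shows "p = (\<Sum>m\<in>A. Poly_Mapping.single m (Poly_Mapping.lookup p m))"
proof (rule poly_mapping_eqI)
  fix k
  show "Poly_Mapping.lookup p k =
      Poly_Mapping.lookup (\<Sum>m\<in>A. Poly_Mapping.single m (Poly_Mapping.lookup p m)) k"
    using assms by (auto simp: lookup_sum lookup_single when_def in_keys_iff)
qed

lemma single_sum_exponents:
  "(\<Prod>x\<in>A. Poly_Mapping.single (m x) (1::'k::field)) = Poly_Mapping.single (sum m A) 1"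
  by (induction A rule: infinite_finite_induct) (auto simp: mult_single)

lemma Var_power: "(Var x :: ('x, 'k::field) mpoly) ^ n = Poly_Mapping.single (Poly_Mapping.single x n) 1"
  by (induction n) (auto simp: Var_def mult_single simp flip: single_add)

lemma monomial_eq_prod_Var:
  "Poly_Mapping.single m (c::'k::field) =
     Const c * (\<Prod>x\<in>Poly_Mapping.keys m. Var x ^ Poly_Mapping.lookup m x)"
  using poly_mapping_sum_monomials[of "Poly_Mapping.keys m" m]
  by (simp add: Var_power single_sum_exponents Const_def mult_single)

text \<open>
  A polynomial ring is the smallest set that contains the constants and the variables and is
  closed under sums and products. Most facts about substitution follow by this induction.
\<close>
lemma polys_induct [consumes 1, case_names Const Var add mult]:
  assumes p: "p \<in> polys X"
    and Const: "\<And>c. P (Const c)"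
    and Var: "\<And>x. x \<in> X \<Longrightarrow> P (Var x)"
    and add: "\<And>p q. p \<in> polys X \<Longrightarrow> q \<in> polys X \<Longrightarrow> P p \<Longrightarrow> P q \<Longrightarrow> P (p + q)"
    and mult: "\<And>p q. p \<in> polys X \<Longrightarrow> q \<in> polys X \<Longrightarrow> P p \<Longrightarrow> P q \<Longrightarrow> P (p * q)"
  shows "P p"
proof -
  have power: "P (Var x ^ n)" if "x \<in> X" for x n
    using that Const[of 1] by (induction n) (auto intro!: mult Var)
  have prod: "P (\<Prod>x\<in>A. Var x ^ n x)" if "A \<subseteq> X" for A n
    using that Const[of 1]
    by (induction A rule: infinite_finite_induct) (auto intro!: mult power polys_prod polys_power)
  have monom: "P (Poly_Mapping.single m c)" if "Poly_Mapping.keys m \<subseteq> X" for m c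
    using that unfolding monomial_eq_prod_Var
    by (intro mult prod Const) (auto intro!: polys_prod polys_power)
  have sum: "P (\<Sum>m\<in>A. Poly_Mapping.single m (c m))"
    if "\<forall>m\<in>A. Poly_Mapping.keys m \<subseteq> X" for A c
    using that Const[of 0]
    by (induction A rule: infinite_finite_induct) (auto intro!: add monom polys_sum polys_single)
  show ?thesis
    using sum[of "Poly_Mapping.keys p" "Poly_Mapping.lookup p"] p
      poly_mapping_sum_monomials[of "Poly_Mapping.keys p" p]
    by (simp add: mem_polys)
qed

definition eval_monom :: "('x \<Rightarrow> ('y, 'k::field) mpoly) \<Rightarrow> ('x \<Rightarrow>\<^sub>0 nat) \<Rightarrow> ('y, 'k) mpoly"
  where "eval_monom f m = (\<Prod>x \<in> Poly_Mapping.keys m. f x ^ Poly_Mapping.lookup m x)"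

lemma eval_monom_superset:
  "finite A \<Longrightarrow> Poly_Mapping.keys m \<subseteq> A \<Longrightarrow> eval_monom f m = (\<Prod>x\<in>A. f x ^ Poly_Mapping.lookup m x)"
  unfolding eval_monom_def by (intro prod.mono_neutral_left) (auto simp: in_keys_iff)

lemma eval_monom_add: "eval_monom f (a + b) = eval_monom f a * eval_monom f b"
proof -
  let ?A = "Poly_Mapping.keys a \<union> Poly_Mapping.keys b"
  show ?thesis
    using Poly_Mapping.keys_add[of a b]
    by (simp add: eval_monom_superset[of ?A] lookup_add power_add prod.distrib)
qed

lemma eval_mpoly_superset:
  "finite A \<Longrightarrow> Poly_Mapping.keys p \<subseteq> A \<Longrightarrow>
    eval_mpoly f p = (\<Sum>m\<in>A. Const (Poly_Mapping.lookup p m) * eval_monom f m)"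
  unfolding eval_mpoly_def eval_monom_def
  by (intro sum.mono_neutral_left) (auto simp: in_keys_iff)

lemma eval_mpoly_add [simp]: "eval_mpoly f (p + q) = eval_mpoly f p + eval_mpoly f q"
proof -
  let ?A = "Poly_Mapping.keys p \<union> Poly_Mapping.keys q"
  show ?thesis
    using Poly_Mapping.keys_add[of p q]
    by (simp add: eval_mpoly_superset[of ?A] lookup_add Const_add distrib_right sum.distrib)
qed

lemma eval_mpoly_0 [simp]: "eval_mpoly f 0 = 0"
  by (simp add: eval_mpoly_def)

lemma eval_mpoly_uminus [simp]: "eval_mpoly f (- p) = - eval_mpoly f p"
  using eval_mpoly_add[of f p "- p"] by (simp add: eq_neg_iff_add_eq_0 add.commute)

lemma eval_mpoly_diff [simp]: "eval_mpoly f (p - q) = eval_mpoly f p - eval_mpoly f q"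
  using eval_mpoly_add[of f p "- q"] by simp

lemma eval_mpoly_sum [simp]: "eval_mpoly f (sum p A) = (\<Sum>i\<in>A. eval_mpoly f (p i))"
  by (induction A rule: infinite_finite_induct) auto

lemma eval_mpoly_single: "eval_mpoly f (Poly_Mapping.single m c) = Const c * eval_monom f m"
  by (cases "c = 0") (simp_all add: eval_mpoly_def eval_monom_def)

lemma eval_mpoly_mult [simp]: "eval_mpoly f (p * q) = eval_mpoly f p * eval_mpoly f q"
proof -
  let ?s = "\<lambda>p m. Poly_Mapping.single m (Poly_Mapping.lookup p m)"
  have "eval_mpoly f ((\<Sum>a\<in>Poly_Mapping.keys p. ?s p a) * (\<Sum>b\<in>Poly_Mapping.keys q. ?s q b)) =
    eval_mpoly f (\<Sum>a\<in>Poly_Mapping.keys p. ?s p a) * eval_mpoly f (\<Sum>b\<in>Poly_Mapping.keys q. ?s q b)"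
    by (simp add: sum_product mult_single eval_mpoly_single Const_mult eval_monom_add ac_simps)
  then show ?thesis
    by (simp flip: poly_mapping_sum_monomials)
qed

lemma eval_mpoly_Const [simp]: "eval_mpoly f (Const c) = Const c"
  by (simp add: Const_def eval_mpoly_single eval_monom_def)

lemma eval_mpoly_1 [simp]: "eval_mpoly f 1 = 1"
  using eval_mpoly_Const[of f 1] by simp

lemma eval_mpoly_Var [simp]: "eval_mpoly f (Var x) = f x"
  by (simp add: Var_def eval_mpoly_single eval_monom_def)

lemma eval_mpoly_prod: "eval_mpoly f (prod p A) = (\<Prod>i\<in>A. eval_mpoly f (p i))"
  by (induction A rule: infinite_finite_induct) auto

lemma eval_mpoly_polys:
  assumes "p \<in> polys X" "\<And>x. x \<in> X \<Longrightarrow> f x \<in> polys Y"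
  shows "eval_mpoly f p \<in> polys Y"
  using assms by (induction rule: polys_induct) auto

lemma eval_mpoly_cong:
  assumes "p \<in> polys X" "\<And>x. x \<in> X \<Longrightarrow> f x = g x"
  shows "eval_mpoly f p = eval_mpoly g p"
  using assms by (induction rule: polys_induct) auto

lemma eval_mpoly_Var_id: "p \<in> polys X \<Longrightarrow> eval_mpoly Var p = p"
  by (induction rule: polys_induct) auto

lemma eval_mpoly_eval_mpoly:
  assumes "p \<in> polys X"
  shows "eval_mpoly g (eval_mpoly f p) = eval_mpoly (\<lambda>x. eval_mpoly g (f x)) p"
  using assms by (induction rule: polys_induct) auto

section \<open>Parts of a polynomial in given degrees\<close>

lemma monom_degree_add: "monom_degree w (a + b) = monom_degree w a + monom_degree w b"
  unfolding monom_degree_def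
  by (rule setsum_keys_plus_distrib) (auto simp: distrib_left)

definition degrees_in :: "('x \<Rightarrow> nat) \<Rightarrow> nat set \<Rightarrow> ('x, 'k::zero) mpoly \<Rightarrow> bool"
  where "degrees_in w D p \<longleftrightarrow> (\<forall>m\<in>Poly_Mapping.keys p. monom_degree w m \<in> D)"

text \<open>
  Allowing a set of degrees covers homogeneous components (\<open>{d}\<close>) and truncations
  (\<open>{d..}\<close>) at once; complementary sets split a polynomial into two summands.
\<close>
definition part :: "('x \<Rightarrow> nat) \<Rightarrow> nat set \<Rightarrow> ('x, 'k::zero) mpoly \<Rightarrow> ('x, 'k) mpoly"
  where "part w D p = Poly_Mapping.mapp (\<lambda>m c. if monom_degree w m \<in> D then c else 0) p"

lemma homogeneous_iff_degrees_in: "homogeneous w d p \<longleftrightarrow> degrees_in w {d} p"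
  by (auto simp: homogeneous_def degrees_in_def)

lemma lookup_part: "Poly_Mapping.lookup (part w D p) m =
    (if monom_degree w m \<in> D then Poly_Mapping.lookup p m else 0)"
  by (auto simp: part_def lookup_mapp in_keys_iff when_def)

lemma keys_part: "Poly_Mapping.keys (part w D p) = {m \<in> Poly_Mapping.keys p. monom_degree w m \<in> D}"
  by (auto simp: in_keys_iff lookup_part split: if_splits)

lemma part_polys [simp]: "p \<in> polys X \<Longrightarrow> part w D p \<in> polys X"
  by (auto simp: mem_polys keys_part)

lemma part_add: "part w D (p + q) = part w D p + part w D q"
  by (rule poly_mapping_eqI) (simp add: lookup_part lookup_add)

lemma part_0 [simp]: "part w D 0 = 0"
  by (rule poly_mapping_eqI) (simp add: lookup_part)

lemma part_uminus: "part w D (- p) = - part w D (p :: ('x, 'k::field) mpoly)"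
  by (rule poly_mapping_eqI) (simp add: lookup_part)

lemma part_sum: "part w D (sum p A) = (\<Sum>i\<in>A. part w D (p i))"
  by (induction A rule: infinite_finite_induct) (auto simp: part_add)

lemma part_eq_self: "degrees_in w D p \<Longrightarrow> part w D p = p"
  by (rule poly_mapping_eqI) (auto simp: lookup_part degrees_in_def in_keys_iff)

lemma part_eq_0: "degrees_in w (- D) p \<Longrightarrow> part w D p = 0"
  by (rule poly_mapping_eqI) (auto simp: lookup_part degrees_in_def in_keys_iff)

lemma degrees_in_part: "degrees_in w D (part w D p)"
  by (auto simp: degrees_in_def keys_part)

lemma part_complement: "part w D p + part w (- D) p = p"
  by (rule poly_mapping_eqI) (simp add: lookup_part lookup_add)

lemma degrees_in_mono: "degrees_in w D p \<Longrightarrow> D \<subseteq> E \<Longrightarrow> degrees_in w E p"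
  by (auto simp: degrees_in_def)

lemma degrees_in_UNIV [simp]: "degrees_in w UNIV p"
  by (auto simp: degrees_in_def)

lemma degrees_in_0 [simp]: "degrees_in w D 0"
  by (auto simp: degrees_in_def)

lemma degrees_in_add: "degrees_in w D p \<Longrightarrow> degrees_in w D q \<Longrightarrow> degrees_in w D (p + q)"
  using Poly_Mapping.keys_add[of p q] by (auto simp: degrees_in_def)

lemma degrees_in_uminus [simp]:
  "degrees_in w D (- p) \<longleftrightarrow> degrees_in w D (p :: ('x, 'k::field) mpoly)"
  by (auto simp: degrees_in_def)

lemma degrees_in_diff:
  "degrees_in w D p \<Longrightarrow> degrees_in w D q \<Longrightarrow> degrees_in w D (p - q :: ('x, 'k::field) mpoly)"
  using degrees_in_add[of w D p "- q"] by simp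

lemma degrees_in_sum: "(\<And>i. i \<in> A \<Longrightarrow> degrees_in w D (p i)) \<Longrightarrow> degrees_in w D (sum p A)"
  by (induction A rule: infinite_finite_induct) (auto intro: degrees_in_add)

lemma degrees_in_mult:
  assumes "degrees_in w D p" "degrees_in w E q" "\<And>a b. a \<in> D \<Longrightarrow> b \<in> E \<Longrightarrow> a + b \<in> F"
  shows "degrees_in w F (p * q)"
  unfolding degrees_in_def
proof
  fix m assume "m \<in> Poly_Mapping.keys (p * q)"
  then obtain a b where "m = a + b" "a \<in> Poly_Mapping.keys p" "b \<in> Poly_Mapping.keys q"
    using keys_mult[of p q] by blast
  then show "monom_degree w m \<in> F"
    using assms by (auto simp: degrees_in_def monom_degree_add)
qed

lemma degrees_in_Const [simp]: "0 \<in> D \<Longrightarrow> degrees_in w D (Const c)"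
  by (auto simp: degrees_in_def Const_def monom_degree_def)

lemma homogeneous_Const [simp]: "homogeneous w 0 (Const c)"
  by (auto simp: homogeneous_iff_degrees_in)

lemma homogeneous_1 [simp]: "homogeneous w 0 (1 :: ('x, 'k::field) mpoly)"
  using homogeneous_Const[of w "1 :: 'k"] by simp

lemma homogeneous_0 [simp]: "homogeneous w d 0"
  by (auto simp: homogeneous_iff_degrees_in)

lemma homogeneous_Var [simp]: "homogeneous w (w x) (Var x :: ('x, 'k::field) mpoly)"
  by (auto simp: homogeneous_def Var_def monom_degree_def)

lemma homogeneous_mult:
  "homogeneous w d p \<Longrightarrow> homogeneous w e q \<Longrightarrow> homogeneous w (d + e) (p * q)"
  unfolding homogeneous_iff_degrees_in by (rule degrees_in_mult) auto

lemma homogeneous_sum: "(\<And>i. i \<in> A \<Longrightarrow> homogeneous w d (p i)) \<Longrightarrow> homogeneous w d (sum p A)"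
  unfolding homogeneous_iff_degrees_in by (rule degrees_in_sum)

lemma homogeneous_uminus [simp]:
  "homogeneous w d (- p) \<longleftrightarrow> homogeneous w d (p :: ('x, 'k::field) mpoly)"
  unfolding homogeneous_iff_degrees_in by simp

lemma homogeneous_power: "homogeneous w d p \<Longrightarrow> homogeneous w (d * n) (p ^ n :: ('x, 'k::field) mpoly)"
  by (induction n) (auto intro: homogeneous_mult)

lemma homogeneous_prod:
  "(\<And>i. i \<in> A \<Longrightarrow> homogeneous w (d i) (p i)) \<Longrightarrow>
    homogeneous w (sum d A) (prod p A :: ('x, 'k::field) mpoly)"
  by (induction A rule: infinite_finite_induct) (auto intro: homogeneous_mult)

lemma homogeneous_part [simp]: "homogeneous w d (part w {d} p)"
  by (simp add: homogeneous_iff_degrees_in degrees_in_part)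

lemma part_Const_eq_0: "0 \<notin> D \<Longrightarrow> part w D (Const c) = 0"
  by (rule part_eq_0) simp

text \<open>
  Multiplication by a homogeneous polynomial shifts degrees, so an identity
  \<open>p = \<Sum> c\<^sub>i f\<^sub>i\<close> with homogeneous \<open>f\<^sub>i\<close> passes to its parts. This is how coefficients of
  arbitrary degree are replaced below by coefficients of the right degree.
\<close>
lemma part_mult_homogeneous:
  assumes f: "homogeneous w e f"
  shows "part w D (p * f) = part w {n. n + e \<in> D} p * (f :: ('x, 'k::field) mpoly)"
proof -
  let ?E = "{n. n + e \<in> D}"
  have "p * f = part w ?E p * f + part w (- ?E) p * f"
    by (simp only: part_complement flip: distrib_right)
  moreover have "part w D (part w ?E p * f) = part w ?E p * f"
    using f by (intro part_eq_self degrees_in_mult[OF degrees_in_part])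
      (auto simp: homogeneous_iff_degrees_in)
  moreover have "part w D (part w (- ?E) p * f) = 0"
    using f by (intro part_eq_0 degrees_in_mult[OF degrees_in_part])
      (auto simp: homogeneous_iff_degrees_in)
  ultimately show ?thesis
    by (simp add: part_add)
qed

lemma part_mult_Var:
  fixes p :: "('x, 'k::field) mpoly"
  shows "part w D (p * Var x) = part w {n. n + w x \<in> D} p * Var x"
  by (rule part_mult_homogeneous) (rule homogeneous_Var)

lemma homogeneous_decomposition:
  fixes p :: "('x, 'k::field) mpoly"
  shows "p = (\<Sum>d \<in> monom_degree w ` Poly_Mapping.keys p. part w {d} p)"
proof (rule poly_mapping_eqI)
  fix m
  show "Poly_Mapping.lookup p m = Poly_Mapping.lookup
      (\<Sum>d \<in> monom_degree w ` Poly_Mapping.keys p. part w {d} p) m"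
    by (auto simp: lookup_sum lookup_part in_keys_iff)
qed

lemma degrees_in_eval_mpoly:
  assumes p: "p \<in> polys X" "degrees_in w D p"
    and f: "\<And>x. x \<in> X \<Longrightarrow> homogeneous v (w x) (f x)"
  shows "degrees_in v D (eval_mpoly f p)"
  unfolding eval_mpoly_def
proof (rule degrees_in_sum)
  fix m assume m: "m \<in> Poly_Mapping.keys p"
  have "homogeneous v (monom_degree w m) (\<Prod>x\<in>Poly_Mapping.keys m. f x ^ Poly_Mapping.lookup m x)"
    unfolding monom_degree_def
    using m p f by (intro homogeneous_prod homogeneous_power) (auto simp: mem_polys)
  then have "homogeneous v (0 + monom_degree w m) (Const (Poly_Mapping.lookup p m) *
      (\<Prod>x\<in>Poly_Mapping.keys m. f x ^ Poly_Mapping.lookup m x))"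
    by (intro homogeneous_mult homogeneous_Const)
  then show "degrees_in v D (Const (Poly_Mapping.lookup p m) *
      (\<Prod>x\<in>Poly_Mapping.keys m. f x ^ Poly_Mapping.lookup m x))"
    using m p by (auto simp: homogeneous_iff_degrees_in degrees_in_def)
qed

text \<open>
  Substituting homogeneous polynomials of degree \<open>w x\<close> for the variables is a graded
  homomorphism. It is used for the group action, where the substituted polynomials are linear
  forms, and for \<open>h \<mapsto> h(f\<^sub>1, \<dots>, f\<^sub>r)\<close>.
\<close>
lemma part_eval_mpoly:
  assumes p: "p \<in> polys X"
    and f: "\<And>x. x \<in> X \<Longrightarrow> homogeneous v (w x) (f x)"
  shows "part v D (eval_mpoly f p) = eval_mpoly f (part w D p)"
proof -
  have "eval_mpoly f p = eval_mpoly f (part w D p) + eval_mpoly f (part w (- D) p)"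
    by (simp add: part_complement flip: eval_mpoly_add)
  moreover have "part v D (eval_mpoly f (part w D p)) = eval_mpoly f (part w D p)"
    using p f by (intro part_eq_self degrees_in_eval_mpoly[where X = X and w = w] degrees_in_part) auto
  moreover have "part v D (eval_mpoly f (part w (- D) p)) = 0"
    using p f by (intro part_eq_0 degrees_in_eval_mpoly[where X = X and w = w] degrees_in_part) auto
  ultimately show ?thesis
    by (simp add: part_add)
qed

section \<open>Koszul relations of the variables\<close>

lemma polynomial_decomposition:
  fixes p :: "('x, 'k::field) mpoly"
  assumes "finite X" "p \<in> polys X"
  shows "\<exists>c u. (\<forall>x. u x \<in> polys X) \<and> p = Const c + (\<Sum>x\<in>X. Var x * u x)"
  using assms(2)
proof (induction rule: polys_induct)
  case (Const c)
  show ?case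
    by (intro exI[of _ c] exI[of _ "\<lambda>_. 0"]) simp
next
  case (Var x)
  have "(\<Sum>y\<in>X. Var y * (if y = x then 1 else 0 :: ('x, 'k) mpoly)) = Var x"
    using Var assms(1) by (simp add: if_distrib cong: if_cong)
  then show ?case
    by (intro exI[of _ 0] exI[of _ "\<lambda>y. if y = x then 1 else 0"]) simp
next
  case (add p q)
  then obtain c u c' u' where "\<forall>x. u x \<in> polys X" "p = Const c + (\<Sum>x\<in>X. Var x * u x)"
    "\<forall>x. u' x \<in> polys X" "q = Const c' + (\<Sum>x\<in>X. Var x * u' x)"
    by blast
  then show ?case
    by (intro exI[of _ "c + c'"] exI[of _ "\<lambda>x. u x + u' x"])
      (simp add: Const_add distrib_left sum.distrib)
next
  case (mult p q)
  then obtain c u c' u' where u: "\<forall>x. u x \<in> polys X" "p = Const c + (\<Sum>x\<in>X. Var x * u x)"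
    "\<forall>x. u' x \<in> polys X" "q = Const c' + (\<Sum>x\<in>X. Var x * u' x)"
    by blast
  have "p * q = Const c * Const c' + Const c * (\<Sum>x\<in>X. Var x * u' x) + (\<Sum>x\<in>X. Var x * u x) * q"
    by (simp add: u algebra_simps)
  also have "\<dots> = Const (c * c') + (\<Sum>x\<in>X. Var x * (Const c * u' x + u x * q))"
    by (simp add: Const_mult sum_distrib_left sum_distrib_right sum.distrib distrib_left ac_simps)
  finally show ?case
    using u mult.hyps by (intro exI[of _ "c * c'"] exI[of _ "\<lambda>x. Const c * u' x + u x * q"]) simp
qed

lemma part_polynomial_decomposition:
  fixes p :: "('x, 'k::field) mpoly"
  assumes X: "finite X" "p \<in> polys X" and D: "0 \<notin> D"
  shows "\<exists>u. (\<forall>x. u x \<in> polys X \<and> degrees_in w {n. n + w x \<in> D} (u x)) \<and>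
    part w D p = (\<Sum>x\<in>X. Var x * u x)"
proof -
  obtain c u where u: "\<forall>x. u x \<in> polys X" "p = Const c + (\<Sum>x\<in>X. Var x * u x)"
    using polynomial_decomposition[OF X] by blast
  have "part w D p = (\<Sum>x\<in>X. Var x * part w {n. n + w x \<in> D} (u x))"
    by (simp add: u part_add part_sum part_Const_eq_0 D mult.commute[of "Var _"] part_mult_Var)
  then show ?thesis
    using u by (intro exI[of _ "\<lambda>x. part w {n. n + w x \<in> D} (u x)"]) (simp add: degrees_in_part)
qed

lemma polys_split_variable:
  fixes p :: "('x, 'k::field) mpoly"
  assumes "x \<notin> X" "p \<in> polys (insert x X)"
  shows "\<exists>q r. q \<in> polys X \<and> r \<in> polys (insert x X) \<and> p = q + Var x * r"
  using assms(2)
proof (induction rule: polys_induct)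
  case (Const c)
  show ?case
    by (intro exI[of _ "Const c"] exI[of _ 0]) simp
next
  case (Var y)
  show ?case
  proof (cases "y = x")
    case True
    then show ?thesis by (intro exI[of _ 0] exI[of _ 1]) simp
  next
    case False
    with Var show ?thesis by (intro exI[of _ "Var y"] exI[of _ 0]) simp
  qed
next
  case (add p p')
  then obtain q r q' r' where "q \<in> polys X" "r \<in> polys (insert x X)" "p = q + Var x * r"
    "q' \<in> polys X" "r' \<in> polys (insert x X)" "p' = q' + Var x * r'"
    by blast
  then show ?case
    by (intro exI[of _ "q + q'"] exI[of _ "r + r'"]) (simp add: distrib_left)
next
  case (mult p p')
  then obtain q r q' r' where *: "q \<in> polys X" "r \<in> polys (insert x X)" "p = q + Var x * r"
    "q' \<in> polys X" "r' \<in> polys (insert x X)" "p' = q' + Var x * r'"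
    by blast
  then have "q \<in> polys (insert x X)" "q' \<in> polys (insert x X)"
    by (auto intro: polys_mono)
  with * show ?case
    by (intro exI[of _ "q * q'"] exI[of _ "q * r' + r * q' + Var x * r * r'"])
      (simp add: algebra_simps)
qed

lemma Var_mult_eq_0:
  fixes p :: "('x, 'k::field) mpoly"
  assumes "Var x * p = 0"
  shows "p = 0"
proof (rule poly_mapping_eqI)
  fix m
  let ?x = "Poly_Mapping.single x (1::nat)"
  have "Var x * p = Var x * (\<Sum>a\<in>Poly_Mapping.keys p. Poly_Mapping.single a (Poly_Mapping.lookup p a))"
    by (simp flip: poly_mapping_sum_monomials)
  also have "\<dots> = (\<Sum>a\<in>Poly_Mapping.keys p. Poly_Mapping.single (?x + a) (Poly_Mapping.lookup p a))"
    by (simp add: Var_def sum_distrib_left mult_single)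
  finally have "Poly_Mapping.lookup (Var x * p) (?x + m) = Poly_Mapping.lookup p m"
    by (auto simp: lookup_sum lookup_single when_def in_keys_iff)
  with assms show "Poly_Mapping.lookup p m = Poly_Mapping.lookup 0 m"
    by simp
qed

text \<open>
  The decomposition in \<open>polys_split_variable\<close> is unique: substituting \<open>0\<close> for \<open>x\<close>
  isolates \<open>q\<close>.
\<close>
lemma split_variable_eq_0:
  fixes q :: "('x, 'k::field) mpoly"
  assumes x: "x \<notin> X" and q: "q \<in> polys X" and eq: "q + Var x * r = 0"
  shows "q = 0" "r = 0"
proof -
  define s :: "'x \<Rightarrow> ('x, 'k) mpoly" where "s = (\<lambda>y. if y = x then 0 else Var y)"
  have "eval_mpoly s q = eval_mpoly Var q"
    using q x by (intro eval_mpoly_cong) (auto simp: s_def)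
  then have "eval_mpoly s (q + Var x * r) = q"
    using q by (simp add: s_def eval_mpoly_Var_id)
  then show "q = 0"
    using eq by simp
  then show "r = 0"
    using eq Var_mult_eq_0[of x r] by simp
qed

text \<open>
  The zero diagonal is a separate condition because antisymmetry does not imply it in
  characteristic 2.
\<close>
definition alternating :: "('i \<Rightarrow> 'i \<Rightarrow> 'a::ab_group_add) \<Rightarrow> bool"
  where "alternating a \<longleftrightarrow> (\<forall>i. a i i = 0) \<and> (\<forall>i j. a i j = - a j i)"

lemma alternating_diag: "alternating a \<Longrightarrow> a i i = 0"
  and alternating_swap: "alternating a \<Longrightarrow> a i j = - a j i"
  unfolding alternating_def by blast+

lemma alternatingI: "(\<And>i. a i i = 0) \<Longrightarrow> (\<And>i j. a i j = - a j i) \<Longrightarrow> alternating a"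
  unfolding alternating_def by blast

text \<open>
  This is the alternating bilinear form of the matrix \<open>a\<close> evaluated at the pair \<open>(y, y)\<close>. The
  induction on \<open>A\<close> cancels the terms in pairs without dividing by 2.
\<close>
lemma alternating_sum_eq_0:
  fixes a :: "'i \<Rightarrow> 'i \<Rightarrow> 'a::comm_ring_1"
  assumes "alternating a"
  shows "(\<Sum>i\<in>A. y i * (\<Sum>j\<in>A. a i j * y j)) = 0"
proof (induction A rule: infinite_finite_induct)
  case (insert k A)
  have "(\<Sum>i\<in>A. y i * (a i k * y k)) = - (y k * (\<Sum>j\<in>A. a k j * y j))"
    unfolding sum_distrib_left sum_negf[symmetric]
  proof (rule sum.cong)
    fix i
    show "y i * (a i k * y k) = - (y k * (a k i * y i))"
      by (simp add: alternating_swap[OF assms, of i k] algebra_simps)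
  qed simp
  moreover have "a k k = 0"
    using assms by (rule alternating_diag)
  ultimately show ?case
    using insert by (simp add: distrib_left sum.distrib)
qed auto

text \<open>
  Entrywise preimages of an alternating matrix under a relation \<open>R\<close> that respects zero and
  negation can be chosen so that they form an alternating matrix again: choose them above the diagonal and extend by
  antisymmetry. The preimages are families indexed by \<open>i\<close>, since a preimage may be a coefficient
  vector.
\<close>
lemma alternating_lift:
  fixes b :: "'a \<Rightarrow> 'a \<Rightarrow> 'b::ab_group_add"
    and R :: "('i \<Rightarrow> 'c::ab_group_add) \<Rightarrow> 'b \<Rightarrow> bool"
  assumes A: "finite A" and b: "alternating b"
    and ex: "\<And>k l. k \<in> A \<Longrightarrow> l \<in> A \<Longrightarrow> \<exists>c. R c (b k l)"
    and zero: "R (\<lambda>_. 0) 0"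
    and uminus: "\<And>c y. R c y \<Longrightarrow> R (\<lambda>i. - c i) (- y)"
  shows "\<exists>c. (\<forall>i. alternating (\<lambda>k l. c k l i)) \<and> (\<forall>k\<in>A. \<forall>l\<in>A. R (c k l) (b k l))"
proof -
  \<comment> \<open>The numbering only serves to say which entries lie above the diagonal.\<close>
  obtain g :: "'a \<Rightarrow> nat" where g: "inj_on g A"
    using finite_imp_inj_to_nat_seg[OF A] by blast
  obtain c where c: "\<And>k l. k \<in> A \<Longrightarrow> l \<in> A \<Longrightarrow> R (c k l) (b k l)"
    using ex by metis
  define c' where "c' = (\<lambda>k l i. if g k < g l then c k l i else if g l < g k then - c l k i else 0)"
  have "R (c' k l) (b k l)" if kl: "k \<in> A" "l \<in> A" for k l
  proof -
    consider "g k < g l" | "g l < g k" | "k = l"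
      using g kl by (meson inj_onD linorder_neqE_nat)
    then show ?thesis
    proof cases
      case 1
      then show ?thesis using c kl by (simp add: c'_def)
    next
      case 2
      with uminus[OF c[of l k]] kl show ?thesis
        by (simp add: c'_def alternating_swap[OF b, of k l])
    next
      case 3
      then show ?thesis using zero by (simp add: c'_def alternating_diag[OF b])
    qed
  qed
  moreover have "alternating (\<lambda>k l. c' k l i)" for i
    by (intro alternatingI) (simp_all add: c'_def)
  ultimately show ?thesis
    by blast
qed

text \<open>
  Exactness of the Koszul complex of the variables at its first step, by induction on the number of
  variables. With \<open>p\<^sub>x = q\<^sub>x + z r\<^sub>x\<close> for the new variable \<open>z\<close>, the relation splits into
  \<open>\<Sum> x q\<^sub>x = 0\<close>, which the induction hypothesis covers, and \<open>p\<^sub>z = - \<Sum> x r\<^sub>x\<close>. So the old matrix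
  is bordered by the column \<open>r\<close> and the row \<open>- r\<close>.
\<close>
lemma koszul_relations_Var:
  fixes p :: "'x \<Rightarrow> ('x, 'k::field) mpoly"
  assumes "finite X" "\<And>x. x \<in> X \<Longrightarrow> p x \<in> polys X" "(\<Sum>x\<in>X. Var x * p x) = 0"
  shows "\<exists>b. alternating b \<and> (\<forall>x y. b x y \<in> polys X) \<and> (\<forall>x\<in>X. p x = (\<Sum>y\<in>X. b x y * Var y))"
  using assms
proof (induction X arbitrary: p rule: finite_induct)
  case empty
  show ?case
    by (intro exI[of _ "\<lambda>_ _. 0"]) (simp add: alternatingI)
next
  case (insert z X)
  have "\<forall>x\<in>insert z X. \<exists>q r. q \<in> polys X \<and> r \<in> polys (insert z X) \<and> p x = q + Var z * r"
    using insert.hyps insert.prems by (intro ballI polys_split_variable) auto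
  then obtain q r where qr: "\<And>x. x \<in> insert z X \<Longrightarrow> q x \<in> polys X"
      "\<And>x. x \<in> insert z X \<Longrightarrow> r x \<in> polys (insert z X)"
      "\<And>x. x \<in> insert z X \<Longrightarrow> p x = q x + Var z * r x"
    by metis
  have "(\<Sum>x\<in>X. Var x * p x) = (\<Sum>x\<in>X. Var x * q x) + Var z * (\<Sum>x\<in>X. Var x * r x)"
    by (simp add: qr distrib_left sum.distrib sum_distrib_left mult.left_commute)
  then have "(\<Sum>x\<in>X. Var x * q x) + Var z * (p z + (\<Sum>x\<in>X. Var x * r x)) = 0"
    using insert by (simp add: algebra_simps)
  moreover have "(\<Sum>x\<in>X. Var x * q x) \<in> polys X"
    using qr by (intro polys_sum polys_mult) auto
  ultimately have q0: "(\<Sum>x\<in>X. Var x * q x) = 0" and pz: "p z + (\<Sum>x\<in>X. Var x * r x) = 0"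
    using split_variable_eq_0[OF insert.hyps(2)] by blast+
  obtain b where b: "alternating b" "\<And>x y. b x y \<in> polys X" "\<And>x. x \<in> X \<Longrightarrow> q x = (\<Sum>y\<in>X. b x y * Var y)"
    using insert.IH[of q] q0 qr by auto
  define b' where "b' = (\<lambda>x y. if x \<in> X \<and> y \<in> X then b x y
    else if x \<in> X \<and> y = z then r x else if x = z \<and> y \<in> X then - r y else 0)"
  have "alternating b'"
  proof (rule alternatingI)
    show "b' x x = 0" for x
      using insert.hyps by (simp add: b'_def alternating_diag[OF b(1)])
    show "b' x y = - b' y x" for x y
    proof (cases "x \<in> X \<and> y \<in> X")
      case True
      then show ?thesis
        by (simp add: b'_def alternating_swap[OF b(1), of x y])
    next
      case False
      then show ?thesis
        by (cases "x \<in> X"; cases "y \<in> X") (simp_all add: b'_def)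
    qed
  qed
  moreover have "b' x y \<in> polys (insert z X)" for x y
    using qr(2) by (auto simp: b'_def intro: polys_mono[OF b(2)])
  moreover have "p x = (\<Sum>y\<in>insert z X. b' x y * Var y)" if "x \<in> insert z X" for x
  proof (cases "x = z")
    case True
    have "(\<Sum>y\<in>X. b' z y * Var y) = - (\<Sum>x\<in>X. Var x * r x)"
      unfolding sum_negf[symmetric] using insert.hyps by (intro sum.cong) (auto simp: b'_def)
    moreover have "b' z z = 0"
      using insert.hyps by (simp add: b'_def)
    moreover have "p z = - (\<Sum>x\<in>X. Var x * r x)"
      using pz by (simp only: eq_neg_iff_add_eq_0)
    ultimately show ?thesis
      using True insert.hyps by simp
  next
    case False
    then have x: "x \<in> X"
      using that by simp
    then have "(\<Sum>y\<in>X. b' x y * Var y) = q x" "b' x z = r x"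
      using b(3) insert.hyps by (auto simp: b'_def)
    then show ?thesis
      using qr(3)[of x] x insert.hyps by (simp add: ac_simps)
  qed
  ultimately show ?case
    by blast
qed

lemma koszul_relations_Var_degrees:
  fixes p :: "'x \<Rightarrow> ('x, 'k::field) mpoly"
  assumes "finite X" "\<And>x. x \<in> X \<Longrightarrow> p x \<in> polys X" "(\<Sum>x\<in>X. Var x * p x) = 0"
    and p: "\<And>x. x \<in> X \<Longrightarrow> degrees_in std_grading {Suc d..} (p x)"
  shows "\<exists>b. alternating b \<and> (\<forall>x y. b x y \<in> polys X \<and> degrees_in std_grading {d..} (b x y)) \<and>
    (\<forall>x\<in>X. p x = (\<Sum>y\<in>X. b x y * Var y))"
proof -
  obtain b where b: "alternating b" "\<And>x y. b x y \<in> polys X" "\<And>x. x \<in> X \<Longrightarrow> p x = (\<Sum>y\<in>X. b x y * Var y)"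
    using koszul_relations_Var[OF assms(1-3)] by blast
  let ?b = "\<lambda>x y. part std_grading {d..} (b x y)"
  have "p x = (\<Sum>y\<in>X. ?b x y * Var y)" if x: "x \<in> X" for x
  proof -
    have "p x = part std_grading {Suc d..} (p x)"
      using p[OF x] by (simp add: part_eq_self)
    also have "\<dots> = (\<Sum>y\<in>X. ?b x y * Var y)"
      by (simp only: b(3)[OF x] part_sum part_mult_Var) (simp add: atLeast_def)
    finally show ?thesis .
  qed
  moreover have "alternating ?b"
  proof (rule alternatingI)
    show "?b x x = 0" for x
      by (simp add: alternating_diag[OF b(1)])
    show "?b x y = - ?b y x" for x y
      by (simp add: alternating_swap[OF b(1), of x y] part_uminus)
  qed
  ultimately show ?thesis
    using b(2) degrees_in_part by (intro exI[of _ ?b]) auto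
qed

section \<open>Ideals and the order filtration\<close>

lemma ideal_polysI:
  assumes "I \<subseteq> polys X" "0 \<in> I" "\<And>p q. p \<in> I \<Longrightarrow> q \<in> I \<Longrightarrow> p + q \<in> I"
    and mult: "\<And>p q. p \<in> polys X \<Longrightarrow> q \<in> I \<Longrightarrow> p * q \<in> I"
  shows "ideal I (mpoly_ring X)"
proof -
  interpret cring "mpoly_ring X" by (rule cring_mpoly_ring)
  have "\<ominus>\<^bsub>mpoly_ring X\<^esub> p \<in> I" if p: "p \<in> I" for p
  proof -
    have "- p \<in> I"
      using mult[of "- 1" p] p by simp
    moreover have "\<ominus>\<^bsub>mpoly_ring X\<^esub> p = - p"
      using p assms(1) by (intro minus_equality) auto
    ultimately show ?thesis by simp
  qed
  then have "subgroup I (add_monoid (mpoly_ring X))"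
    using assms by (intro subgroup.intro) (auto simp: a_inv_def)
  moreover have "q * p \<in> I" if "p \<in> polys X" "q \<in> I" for p q
    using mult[OF that] by (simp add: mult.commute)
  ultimately show ?thesis
    using mult by (intro idealI ring_axioms) auto
qed

lemma ideal_polysD:
  assumes I: "ideal I (mpoly_ring X)"
  shows "I \<subseteq> polys X" "0 \<in> I" "p \<in> I \<Longrightarrow> q \<in> I \<Longrightarrow> p + q \<in> I"
    "p \<in> polys X \<Longrightarrow> q \<in> I \<Longrightarrow> p * q \<in> I"
  using additive_subgroup.a_subset[OF ideal.axioms(1)[OF I]]
    additive_subgroup.zero_closed[OF ideal.axioms(1)[OF I]]
    additive_subgroup.a_closed[OF ideal.axioms(1)[OF I], of p q]
    ideal.I_l_closed[OF I, of q p]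
  by auto

lemma ideal_polys_sum:
  "ideal I (mpoly_ring X) \<Longrightarrow> (\<And>i. i \<in> A \<Longrightarrow> p i \<in> I) \<Longrightarrow> sum p A \<in> I"
  by (induction A rule: infinite_finite_induct) (auto intro: ideal_polysD)

lemma ideal_Idl_polys: "S \<subseteq> polys X \<Longrightarrow> ideal (Idl\<^bsub>mpoly_ring X\<^esub> S) (mpoly_ring X)"
  by (rule ring.genideal_ideal[OF cring.axioms(1)[OF cring_mpoly_ring]])

lemma Idl_polys_superset: "S \<subseteq> polys X \<Longrightarrow> S \<subseteq> Idl\<^bsub>mpoly_ring X\<^esub> S"
  by (rule ring.genideal_self[OF cring.axioms(1)[OF cring_mpoly_ring]])

lemma Idl_polys_minimal: "ideal I (mpoly_ring X) \<Longrightarrow> S \<subseteq> I \<Longrightarrow> Idl\<^bsub>mpoly_ring X\<^esub> S \<subseteq> I"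
  by (rule ring.genideal_minimal[OF cring.axioms(1)[OF cring_mpoly_ring]])

definition combinations :: "'x set \<Rightarrow> 'i set \<Rightarrow> ('i \<Rightarrow> ('x, 'k::field) mpoly) \<Rightarrow> ('x, 'k) mpoly set"
  where "combinations X A f = {\<Sum>i\<in>A. c i * f i | c. \<forall>i. c i \<in> polys X}"

lemma ideal_combinations:
  assumes "\<And>i. i \<in> A \<Longrightarrow> f i \<in> polys X"
  shows "ideal (combinations X A f) (mpoly_ring X)"
proof (rule ideal_polysI)
  show "combinations X A f \<subseteq> polys X"
    using assms by (auto simp: combinations_def)
  show "0 \<in> combinations X A f"
    unfolding combinations_def by (auto intro!: exI[of _ "\<lambda>_. 0"])
  fix p q
  assume q: "q \<in> combinations X A f"
  then obtain c where c: "\<forall>i. c i \<in> polys X" "q = (\<Sum>i\<in>A. c i * f i)"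
    by (auto simp: combinations_def)
  show "p * q \<in> combinations X A f" if "p \<in> polys X"
    using c that unfolding combinations_def
    by (auto intro!: exI[of _ "\<lambda>i. p * c i"] simp: sum_distrib_left mult.assoc)
  assume "p \<in> combinations X A f"
  then obtain b where "\<forall>i. b i \<in> polys X" "p = (\<Sum>i\<in>A. b i * f i)"
    by (auto simp: combinations_def)
  with c show "p + q \<in> combinations X A f"
    unfolding combinations_def
    by (auto intro!: exI[of _ "\<lambda>i. b i + c i"] simp: sum.distrib distrib_right)
qed

text \<open>
  Syzygies are controlled by the filtration by order and not by homogeneous components. A
  coefficient that should have degree \<open>e - d\<close> is then just required to have order at least the
  truncated difference \<open>e - d\<close>, which is no condition if \<open>d \<ge> e\<close>.
\<close>
definition order_ge :: "nat \<Rightarrow> ('x, 'k::zero) mpoly \<Rightarrow> bool"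
  where "order_ge n p \<longleftrightarrow> degrees_in std_grading {n..} p"

lemma order_ge_zero [simp]: "order_ge n 0" and order_ge_0 [simp]: "order_ge 0 p"
  by (simp_all add: order_ge_def degrees_in_def)

lemma order_ge_mono: "order_ge n p \<Longrightarrow> m \<le> n \<Longrightarrow> order_ge m p"
  unfolding order_ge_def by (erule degrees_in_mono) auto

lemma order_ge_uminus [simp]: "order_ge n (- p) \<longleftrightarrow> order_ge n (p :: ('x, 'k::field) mpoly)"
  by (simp add: order_ge_def)

lemma order_ge_diff:
  "order_ge n p \<Longrightarrow> order_ge n q \<Longrightarrow> order_ge n (p - q :: ('x, 'k::field) mpoly)"
  unfolding order_ge_def by (rule degrees_in_diff)

lemma order_ge_sum: "(\<And>i. i \<in> A \<Longrightarrow> order_ge n (p i)) \<Longrightarrow> order_ge n (sum p A)"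
  unfolding order_ge_def by (rule degrees_in_sum)

lemma order_ge_mult: "order_ge m p \<Longrightarrow> order_ge n q \<Longrightarrow> l \<le> m + n \<Longrightarrow> order_ge l (p * q)"
  unfolding order_ge_def by (rule degrees_in_mult) auto

lemma order_ge_homogeneous: "homogeneous std_grading d p \<Longrightarrow> order_ge d p"
  by (auto simp: homogeneous_def order_ge_def degrees_in_def)

lemma order_ge_Var [simp]: "order_ge 1 (Var x :: ('x, 'k::field) mpoly)"
  using homogeneous_Var[of std_grading x] by (rule order_ge_homogeneous)

lemma order_ge_polynomial_decomposition:
  fixes p :: "('x, 'k::field) mpoly"
  assumes "finite X" "p \<in> polys X" "order_ge (Suc n) p"
  shows "\<exists>u. (\<forall>x. u x \<in> polys X \<and> order_ge n (u x)) \<and> p = (\<Sum>x\<in>X. Var x * u x)"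
proof -
  have "part std_grading {Suc n..} p = p"
    using assms(3) unfolding order_ge_def by (rule part_eq_self)
  moreover have "{m. m + 1 \<in> {Suc n..}} = {n..}"
    by auto
  ultimately show ?thesis
    using part_polynomial_decomposition[OF assms(1,2), of "{Suc n..}" std_grading]
    unfolding order_ge_def by simp
qed

text \<open>
  Every form of degree greater than \<open>d\<close> is a combination of forms of one degree less, so an
  ideal that contains all forms of degree \<open>d\<close> contains all forms of higher degree.
\<close>
lemma ideal_contains_order_ge:
  fixes p :: "('x, 'k::field) mpoly"
  assumes I: "ideal I (mpoly_ring X)" and X: "finite X"
    and d: "\<And>p. p \<in> polys X \<Longrightarrow> homogeneous std_grading d p \<Longrightarrow> p \<in> I"
    and p: "p \<in> polys X" "order_ge d p"
  shows "p \<in> I"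
proof -
  have hom: "p \<in> I" if "p \<in> polys X" "homogeneous std_grading (d + n) p" for p n
    using that
  proof (induction n arbitrary: p)
    case 0
    then show ?case using d by simp
  next
    case (Suc n)
    have "{m. m + 1 \<in> {d + Suc n}} = {d + n}"
      by auto
    then obtain u where u: "\<forall>x. u x \<in> polys X \<and> homogeneous std_grading (d + n) (u x)"
      "part std_grading {d + Suc n} p = (\<Sum>x\<in>X. Var x * u x)"
      using part_polynomial_decomposition[OF X Suc.prems(1), of "{d + Suc n}" std_grading]
      by (auto simp: homogeneous_iff_degrees_in)
    then have "p = (\<Sum>x\<in>X. Var x * u x)"
      using Suc.prems(2) part_eq_self by (fastforce simp: homogeneous_iff_degrees_in)
    moreover have "(\<Sum>x\<in>X. Var x * u x) \<in> I"
      using u Suc.IH by (intro ideal_polys_sum[OF I] ideal_polysD(4)[OF I]) auto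
    ultimately show ?case
      by simp
  qed
  have "part std_grading {e} p \<in> I" if "e \<in> monom_degree std_grading ` Poly_Mapping.keys p" for e
  proof -
    have "d \<le> e"
      using that p(2) by (auto simp: order_ge_def degrees_in_def)
    then show ?thesis
      using hom[of "part std_grading {e} p" "e - d"] p(1) by simp
  qed
  then have "(\<Sum>e \<in> monom_degree std_grading ` Poly_Mapping.keys p. part std_grading {e} p) \<in> I"
    by (rule ideal_polys_sum[OF I])
  then show ?thesis
    by (simp flip: homogeneous_decomposition)
qed

section \<open>Syzygies of high degree are Koszul relations\<close>

locale ideal_of_high_degrees =
  fixes X :: "'x set" and A :: "'i set" and f :: "'i \<Rightarrow> ('x, 'k::field) mpoly"
    and d :: "'i \<Rightarrow> nat" and \<tau> :: nat
  assumes finite_X: "finite X" and finite_A: "finite A"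
    and f_polys: "i \<in> A \<Longrightarrow> f i \<in> polys X"
    and f_homogeneous: "i \<in> A \<Longrightarrow> homogeneous std_grading (d i) (f i)"
    and d_le: "i \<in> A \<Longrightarrow> d i \<le> \<tau>"
    and order_ge_in_combinations:
      "p \<in> polys X \<Longrightarrow> order_ge \<tau> p \<Longrightarrow> p \<in> combinations X A f"
begin

text \<open>Here \<open>e\<close> bounds the degrees of the products \<open>w i * f i\<close> from below.\<close>
definition syzygy :: "nat \<Rightarrow> ('i \<Rightarrow> ('x, 'k) mpoly) \<Rightarrow> bool"
  where "syzygy e w \<longleftrightarrow> (\<forall>i\<in>A. w i \<in> polys X \<and> order_ge (e - d i) (w i)) \<and> (\<Sum>i\<in>A. w i * f i) = 0"

text \<open>
  A combination of the trivial syzygies \<open>f\<^sub>j e\<^sub>i - f\<^sub>i e\<^sub>j\<close>, one for each unordered pair of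
  indices; its coefficient is the entry \<open>a i j\<close>.
\<close>
definition koszul :: "('i \<Rightarrow> ('x, 'k) mpoly) \<Rightarrow> bool"
  where "koszul w \<longleftrightarrow> (\<exists>a. alternating a \<and> (\<forall>i j. a i j \<in> polys X) \<and>
    (\<forall>i\<in>A. w i = (\<Sum>j\<in>A. a i j * f j)))"

lemma combination_of_order_ge:
  assumes p: "p \<in> polys X" "order_ge e p" and e: "\<tau> \<le> e"
  shows "\<exists>c. (\<forall>i. c i \<in> polys X \<and> order_ge (e - d i) (c i)) \<and> p = (\<Sum>i\<in>A. c i * f i)"
proof -
  have "order_ge \<tau> p"
    using p(2) e by (rule order_ge_mono)
  then obtain c where c: "\<forall>i. c i \<in> polys X" "p = (\<Sum>i\<in>A. c i * f i)"
    using order_ge_in_combinations[OF p(1)] by (auto simp: combinations_def)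
  define c' where "c' i = part std_grading {n. n + d i \<in> {e..}} (c i)" for i
  have "p = part std_grading {e..} p"
    using p(2) by (simp only: order_ge_def part_eq_self)
  also have "\<dots> = (\<Sum>i\<in>A. c' i * f i)"
    unfolding c(2) part_sum c'_def by (intro sum.cong refl part_mult_homogeneous f_homogeneous)
  finally have "p = (\<Sum>i\<in>A. c' i * f i)" .
  moreover have "order_ge (e - d i) (c' i)" for i
    unfolding order_ge_def c'_def by (rule degrees_in_mono[OF degrees_in_part]) auto
  ultimately show ?thesis
    using c(1) by (intro exI[of _ c']) (simp add: c'_def)
qed

text \<open>
  The syzygies of degree \<open>e + 1 \<ge> \<tau> + 2\<close> come from those of degree \<open>e\<close>. Write
  \<open>w\<^sub>i = \<Sum> x v\<^sub>i\<^sub>x\<close>. The vectors \<open>(v\<^sub>i\<^sub>x)\<^sub>i\<close> need not be syzygies, but their defects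
  \<open>p\<^sub>x = \<Sum>\<^sub>i v\<^sub>i\<^sub>x f\<^sub>i\<close> satisfy \<open>\<Sum> x p\<^sub>x = 0\<close>. Hence \<open>p\<^sub>x = \<Sum>\<^sub>y b\<^sub>x\<^sub>y y\<close> with \<open>b\<close> alternating of
  order at least \<open>e - 1 \<ge> \<tau>\<close>, so \<open>b\<^sub>x\<^sub>y = \<Sum>\<^sub>i c\<^sub>x\<^sub>y\<^sub>i f\<^sub>i\<close>. Subtracting \<open>\<Sum>\<^sub>y c\<^sub>x\<^sub>y\<^sub>i y\<close> from \<open>v\<^sub>i\<^sub>x\<close>
  removes the defects and does not change \<open>w\<close>, because \<open>c\<close> can be taken alternating.
\<close>
lemma syzygy_decomposition:
  assumes w: "syzygy (Suc e) w" and e: "\<tau> < e"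
  shows "\<exists>u. (\<forall>x\<in>X. syzygy e (u x)) \<and> (\<forall>i\<in>A. w i = (\<Sum>x\<in>X. Var x * u x i))"
proof -
  have de: "d i < e" if "i \<in> A" for i
    using d_le[OF that] e by simp
  have "\<forall>i\<in>A. \<exists>v. (\<forall>x. v x \<in> polys X \<and> order_ge (e - d i) (v x)) \<and> w i = (\<Sum>x\<in>X. Var x * v x)"
  proof (intro ballI, rule order_ge_polynomial_decomposition[OF finite_X])
    fix i assume i: "i \<in> A"
    have "Suc e - d i = Suc (e - d i)"
      using de[OF i] by simp
    then show "w i \<in> polys X" "order_ge (Suc (e - d i)) (w i)"
      using w i by (auto simp: syzygy_def)
  qed
  from bchoice[OF this] obtain v where
    "\<forall>i\<in>A. (\<forall>x. v i x \<in> polys X \<and> order_ge (e - d i) (v i x)) \<and> w i = (\<Sum>x\<in>X. Var x * v i x)"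
    by blast
  then have v: "\<And>i x. i \<in> A \<Longrightarrow> v i x \<in> polys X"
      "\<And>i x. i \<in> A \<Longrightarrow> order_ge (e - d i) (v i x)"
      "\<And>i. i \<in> A \<Longrightarrow> w i = (\<Sum>x\<in>X. Var x * v i x)"
    by simp_all
  define p where "p x = (\<Sum>i\<in>A. v i x * f i)" for x
  have p_polys: "p x \<in> polys X" for x
    unfolding p_def using v(1) f_polys by (intro polys_sum polys_mult)
  have p_order: "order_ge e (p x)" for x
    unfolding p_def
    by (intro order_ge_sum order_ge_mult[OF v(2) order_ge_homogeneous[OF f_homogeneous]]) auto
  have "(\<Sum>x\<in>X. Var x * p x) = (\<Sum>i\<in>A. \<Sum>x\<in>X. Var x * v i x * f i)"
    unfolding p_def sum_distrib_left by (subst sum.swap) (simp add: mult.assoc)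
  also have "\<dots> = (\<Sum>i\<in>A. w i * f i)"
    by (simp add: v(3) sum_distrib_right)
  finally have p_rel: "(\<Sum>x\<in>X. Var x * p x) = 0"
    using w by (simp add: syzygy_def)
  obtain b where b: "alternating b" "\<And>x y. b x y \<in> polys X" "\<And>x y. order_ge (e - 1) (b x y)"
      "\<And>x. x \<in> X \<Longrightarrow> p x = (\<Sum>y\<in>X. b x y * Var y)"
    using koszul_relations_Var_degrees[OF finite_X p_polys p_rel, of "e - 1"] p_order e
    by (auto simp: order_ge_def)
  define R where "R c y \<longleftrightarrow> (\<forall>i. c i \<in> polys X \<and> order_ge (e - 1 - d i) (c i)) \<and> y = (\<Sum>i\<in>A. c i * f i)"
    for c y
  have "\<exists>c. R c (b x y)" for x y
    unfolding R_def using e by (intro combination_of_order_ge b) simp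
  moreover have "R (\<lambda>_. 0) 0" and "R c y \<Longrightarrow> R (\<lambda>i. - c i) (- y)" for c y
    by (auto simp: R_def sum_negf)
  ultimately obtain c where c: "\<And>i. alternating (\<lambda>x y. c x y i)" "\<And>x y. x \<in> X \<Longrightarrow> y \<in> X \<Longrightarrow> R (c x y) (b x y)"
    using alternating_lift[OF finite_X b(1), of R] by blast
  define u where "u x i = v i x - (\<Sum>y\<in>X. c x y i * Var y)" for x i
  have "syzygy e (u x)" if x: "x \<in> X" for x
    unfolding syzygy_def
  proof (intro conjI ballI)
    fix i assume i: "i \<in> A"
    show "u x i \<in> polys X"
      using v(1)[OF i] c(2)[OF x] by (auto simp: u_def R_def)
    have "order_ge (e - d i) (c x y i * Var y)" if "y \<in> X" for y
      using c(2)[OF x that] de[OF i]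
      by (intro order_ge_mult[OF _ order_ge_Var, of "e - 1 - d i"]) (auto simp: R_def)
    then show "order_ge (e - d i) (u x i)"
      unfolding u_def by (intro order_ge_diff order_ge_sum v(2) i)
  next
    have "(\<Sum>i\<in>A. (\<Sum>y\<in>X. c x y i * Var y) * f i) = (\<Sum>y\<in>X. (\<Sum>i\<in>A. c x y i * f i) * Var y)"
      unfolding sum_distrib_right by (subst sum.swap) (simp add: ac_simps)
    also have "\<dots> = (\<Sum>y\<in>X. b x y * Var y)"
      using c(2)[OF x] by (intro sum.cong) (auto simp: R_def)
    finally show "(\<Sum>i\<in>A. u x i * f i) = 0"
      using b(4)[OF x] by (simp add: u_def left_diff_distrib sum_subtractf p_def)
  qed
  moreover have "w i = (\<Sum>x\<in>X. Var x * u x i)" if i: "i \<in> A" for i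
    using alternating_sum_eq_0[OF c(1)[of i], where y = Var and A = X] v(3)[OF i]
    by (simp add: u_def right_diff_distrib sum_subtractf)
  ultimately show ?thesis
    by (intro exI[of _ u]) auto
qed

lemma koszul_sum:
  assumes "\<And>x. x \<in> Y \<Longrightarrow> koszul (w x)"
  shows "koszul (\<lambda>i. \<Sum>x\<in>Y. w x i)"
proof -
  have "\<forall>x\<in>Y. \<exists>a. alternating a \<and> (\<forall>i j. a i j \<in> polys X) \<and> (\<forall>i\<in>A. w x i = (\<Sum>j\<in>A. a i j * f j))"
    using assms unfolding koszul_def by blast
  from bchoice[OF this] obtain a where
    "\<forall>x\<in>Y. alternating (a x) \<and> (\<forall>i j. a x i j \<in> polys X) \<and> (\<forall>i\<in>A. w x i = (\<Sum>j\<in>A. a x i j * f j))"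
    by blast
  then have a: "\<And>x. x \<in> Y \<Longrightarrow> alternating (a x)" "\<And>x i j. x \<in> Y \<Longrightarrow> a x i j \<in> polys X"
    "\<And>x i. x \<in> Y \<Longrightarrow> i \<in> A \<Longrightarrow> w x i = (\<Sum>j\<in>A. a x i j * f j)"
    by simp_all
  have "alternating (\<lambda>i j. \<Sum>x\<in>Y. a x i j)"
  proof (rule alternatingI)
    show "(\<Sum>x\<in>Y. a x i i) = 0" for i
      using alternating_diag[OF a(1)] by simp
    show "(\<Sum>x\<in>Y. a x i j) = - (\<Sum>x\<in>Y. a x j i)" for i j
      unfolding sum_negf[symmetric] by (intro sum.cong refl alternating_swap[OF a(1)])
  qed
  moreover have "(\<Sum>x\<in>Y. w x i) = (\<Sum>j\<in>A. (\<Sum>x\<in>Y. a x i j) * f j)" if "i \<in> A" for i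
    using that by (simp add: a(3) sum_distrib_right) (rule sum.swap)
  ultimately show ?thesis
    unfolding koszul_def using a(2) by (intro exI[of _ "\<lambda>i j. \<Sum>x\<in>Y. a x i j"]) auto
qed

lemma koszul_cong: "koszul w \<Longrightarrow> (\<And>i. i \<in> A \<Longrightarrow> w i = w' i) \<Longrightarrow> koszul w'"
  unfolding koszul_def by auto

text \<open>
  Modulo the syzygies \<open>f\<^sub>j e\<^sub>i - f\<^sub>i e\<^sub>j\<close>, the vector \<open>f\<^sub>j w = \<Sum>\<^sub>i w\<^sub>i f\<^sub>j e\<^sub>i\<close> equals
  \<open>(\<Sum>\<^sub>i w\<^sub>i f\<^sub>i) e\<^sub>j = 0\<close>.
\<close>
lemma koszul_generator_mult:
  assumes w: "syzygy e w" and j: "j \<in> A" and c: "c \<in> polys X"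
  shows "koszul (\<lambda>i. c * f j * w i)"
proof -
  \<comment> \<open>The definition of \<open>koszul\<close> constrains the matrix also outside \<open>A\<close>, where nothing is known
    about \<open>w\<close>.\<close>
  define w' where "w' i = (if i \<in> A then c * w i else 0)" for i
  define a where "a i k = (if k = j then w' i else 0) - (if i = j then w' k else 0)" for i k
  have "alternating a"
    by (intro alternatingI) (simp_all add: a_def)
  moreover have "a i k \<in> polys X" for i k
    using w c by (auto simp: a_def w'_def syzygy_def intro!: polys_diff polys_mult)
  moreover have "c * f j * w i = (\<Sum>k\<in>A. a i k * f k)" if i: "i \<in> A" for i
  proof -
    have "(\<Sum>k\<in>A. (if k = j then w' i else 0) * f k) = w' i * f j"
      using finite_A j by (simp add: if_distrib[of "\<lambda>c. c * _"] cong: if_cong)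
    moreover have "(\<Sum>k\<in>A. w' k * f k) = c * (\<Sum>k\<in>A. w k * f k)"
      by (simp add: w'_def sum_distrib_left mult.assoc)
    then have "(\<Sum>k\<in>A. (if i = j then w' k else 0) * f k) = 0"
      using w by (cases "i = j") (simp_all add: syzygy_def)
    ultimately show ?thesis
      using i by (simp add: a_def left_diff_distrib sum_subtractf w'_def)
  qed
  ultimately show ?thesis
    unfolding koszul_def by blast
qed

text \<open>
  By \<open>syzygy_decomposition\<close>, each degree of \<open>w\<close> above \<open>\<tau> + 1\<close> can be traded for one degree of the
  multiplier \<open>s\<close>; once \<open>s\<close> has order \<open>\<tau>\<close>, it lies in the ideal and \<open>koszul_generator_mult\<close> applies.
\<close>
lemma koszul_of_order_ge:
  assumes "syzygy (\<tau> + 1 + n) w" "s \<in> polys X" "order_ge (\<tau> - n) s"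
  shows "koszul (\<lambda>i. s * w i)"
  using assms
proof (induction n arbitrary: w s)
  case 0
  then obtain c where c: "\<forall>i. c i \<in> polys X" "s = (\<Sum>i\<in>A. c i * f i)"
    using order_ge_in_combinations[of s] by (auto simp: combinations_def)
  have "koszul (\<lambda>i. \<Sum>j\<in>A. c j * f j * w i)"
    using 0 c(1) by (intro koszul_sum koszul_generator_mult) auto
  then show ?case
    by (simp add: c(2) sum_distrib_right)
next
  case (Suc n)
  then have "syzygy (Suc (\<tau> + 1 + n)) w"
    by simp
  then obtain u where u: "\<And>x. x \<in> X \<Longrightarrow> syzygy (\<tau> + 1 + n) (u x)"
    "\<And>i. i \<in> A \<Longrightarrow> w i = (\<Sum>x\<in>X. Var x * u x i)"
    using syzygy_decomposition[of "\<tau> + 1 + n" w] by (metis less_add_one trans_less_add1)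
  have "koszul (\<lambda>i. s * Var x * u x i)" if x: "x \<in> X" for x
  proof (rule Suc.IH[OF u(1)[OF x]])
    show "s * Var x \<in> polys X"
      using Suc.prems(2) x by simp
    show "order_ge (\<tau> - n) (s * Var x)"
      by (rule order_ge_mult[OF Suc.prems(3) order_ge_Var]) simp
  qed
  then have "koszul (\<lambda>i. \<Sum>x\<in>X. s * Var x * u x i)"
    by (rule koszul_sum)
  then show ?case
    by (rule koszul_cong) (simp add: u(2) sum_distrib_left mult.assoc)
qed

theorem syzygy_imp_koszul:
  assumes "syzygy (2 * \<tau> + 1) w"
  shows "koszul w"
proof -
  have "2 * \<tau> + 1 = \<tau> + 1 + \<tau>"
    by simp
  then have "syzygy (\<tau> + 1 + \<tau>) w"
    using assms by metis
  then show ?thesis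
    using koszul_of_order_ge[of \<tau> w 1] by simp
qed

end

section \<open>The action on polynomials and the Reynolds operator\<close>

lemma Const_mult_Const_inverse:
  fixes c :: "'k::field"
  shows "c \<noteq> 0 \<Longrightarrow> Const (inverse c) * Const c = 1"
  by (simp flip: Const_mult)

context finite_dim_representation
begin

abbreviation "act \<equiv> poly_action G scale Basis \<rho>"

abbreviation "invs \<equiv> invariants G scale Basis \<rho>"

abbreviation "hilb \<equiv> hilbert_ideal G scale Basis \<rho>"

definition coordinate_image :: "'g \<Rightarrow> 'v \<Rightarrow> ('v, 'k) mpoly"
  where "coordinate_image g b = (\<Sum>c\<in>Basis. Const (representation Basis (\<rho> (inv g) c) b) * Var c)"

lemma act_def: "act g = eval_mpoly (coordinate_image g)"
  by (simp add: poly_action_def coordinate_image_def[abs_def])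

lemma coordinate_image_polys: "coordinate_image g b \<in> polys Basis"
  by (simp add: coordinate_image_def)

lemma coordinate_image_homogeneous: "homogeneous std_grading 1 (coordinate_image g b)"
  unfolding coordinate_image_def
  using homogeneous_mult[OF homogeneous_Const homogeneous_Var, of std_grading]
  by (intro homogeneous_sum) simp

lemma act_ring_hom [simp]:
  "act g 0 = 0" "act g 1 = 1" "act g (p + q) = act g p + act g q"
  "act g (p * q) = act g p * act g q" "act g (- p) = - act g p" "act g (Const c) = Const c"
  by (simp_all add: act_def)

lemma act_sum: "act g (sum p A) = (\<Sum>i\<in>A. act g (p i))"
  by (simp add: act_def)

lemma act_prod: "act g (prod p A) = (\<Prod>i\<in>A. act g (p i))"
  by (simp add: act_def eval_mpoly_prod)

lemma act_polys [simp]: "p \<in> polys Basis \<Longrightarrow> act g p \<in> polys Basis"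
  unfolding act_def by (rule eval_mpoly_polys) (auto simp: coordinate_image_polys)

lemma part_act: "p \<in> polys Basis \<Longrightarrow> part std_grading D (act g p) = act g (part std_grading D p)"
  unfolding act_def by (intro part_eval_mpoly coordinate_image_homogeneous)

lemma act_homogeneous:
  "p \<in> polys Basis \<Longrightarrow> homogeneous std_grading d p \<Longrightarrow> homogeneous std_grading d (act g p)"
  unfolding act_def homogeneous_iff_degrees_in[of _ d]
  by (rule degrees_in_eval_mpoly[where w = std_grading and X = Basis])
    (simp_all only: coordinate_image_homogeneous)

text \<open>
  The product of the representing matrices of \<open>\<rho> h\<inverse>\<close> and \<open>\<rho> g\<inverse>\<close> is that of \<open>\<rho> (g h)\<inverse>\<close>.
\<close>
lemma act_coordinate_image:
  assumes g: "g \<in> carrier G" and h: "h \<in> carrier G"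
  shows "act g (coordinate_image h b) = coordinate_image (g \<otimes> h) b"
proof -
  have coeff: "(\<Sum>c\<in>Basis. representation Basis (\<rho> (inv h) c) b * representation Basis (\<rho> (inv g) d) c) =
      representation Basis (\<rho> (inv (g \<otimes> h)) d) b" for d
  proof -
    interpret lin: Vector_Spaces.linear scale scale "\<rho> (inv h)"
      using h by (intro \<rho>_linear) simp
    let ?r = "representation Basis (\<rho> (inv g) d)"
    have v: "(\<Sum>c\<in>Basis. scale (?r c) c) = \<rho> (inv g) d"
      using sum_representation_eq[OF independent_Basis _ finite_Basis] by (simp add: span_Basis)
    have "\<rho> (inv (g \<otimes> h)) d = \<rho> (inv h) (\<rho> (inv g) d)"
      using g h by (simp add: inv_mult_group \<rho>_mult)
    also have "\<dots> = (\<Sum>c\<in>Basis. scale (?r c) (\<rho> (inv h) c))"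
      by (subst v[symmetric]) (simp add: lin.sum lin.scale)
    finally have "representation Basis (\<rho> (inv (g \<otimes> h)) d) =
        (\<lambda>b. \<Sum>c\<in>Basis. representation Basis (scale (?r c) (\<rho> (inv h) c)) b)"
      by (simp add: representation_sum independent_Basis span_Basis)
    then show ?thesis
      by (simp add: representation_scale independent_Basis span_Basis mult.commute)
  qed
  have "act g (coordinate_image h b) = (\<Sum>c\<in>Basis. \<Sum>d\<in>Basis.
      Const (representation Basis (\<rho> (inv h) c) b * representation Basis (\<rho> (inv g) d) c) * Var d)"
    by (subst coordinate_image_def)
      (simp add: act_def, simp add: coordinate_image_def sum_distrib_left Const_mult mult.assoc)
  also have "\<dots> = (\<Sum>d\<in>Basis. Const (\<Sum>c\<in>Basis.
      representation Basis (\<rho> (inv h) c) b * representation Basis (\<rho> (inv g) d) c) * Var d)"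
    by (subst sum.swap) (simp add: Const_sum sum_distrib_right)
  also have "\<dots> = coordinate_image (g \<otimes> h) b"
    by (simp add: coeff coordinate_image_def)
  finally show ?thesis .
qed

lemma act_act:
  assumes "g \<in> carrier G" "h \<in> carrier G" "p \<in> polys Basis"
  shows "act g (act h p) = act (g \<otimes> h) p"
proof -
  have "act g (act h p) = eval_mpoly (\<lambda>b. act g (coordinate_image h b)) p"
    using eval_mpoly_eval_mpoly[OF assms(3)] by (simp add: act_def)
  also have "\<dots> = act (g \<otimes> h) p"
    using act_coordinate_image[OF assms(1,2)] by (simp add: act_def)
  finally show ?thesis .
qed

lemma act_one:
  assumes "p \<in> polys Basis"
  shows "act \<one> p = p"
proof -
  have "coordinate_image \<one> b = Var b" if "b \<in> Basis" for b
    using that by (simp add: coordinate_image_def \<rho>_one representation_basis independent_Basis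
        if_distrib[of Const] if_distrib[of "\<lambda>c. c * _"] finite_Basis cong: if_cong)
  then have "act \<one> p = eval_mpoly Var p"
    unfolding act_def by (intro eval_mpoly_cong[OF assms])
  then show ?thesis
    using eval_mpoly_Var_id[OF assms] by simp
qed

lemma invs_iff: "p \<in> invs \<longleftrightarrow> p \<in> polys Basis \<and> (\<forall>g\<in>carrier G. act g p = p)"
  by (auto simp: invariants_def)

lemma invs_polys: "p \<in> invs \<Longrightarrow> p \<in> polys Basis"
  by (simp add: invs_iff)

lemma invs_mult: "p \<in> invs \<Longrightarrow> q \<in> invs \<Longrightarrow> p * q \<in> invs"
  by (simp add: invs_iff)

lemma invs_Const: "Const c \<in> invs"
  by (simp add: invs_iff)

lemma invs_part: "p \<in> invs \<Longrightarrow> part std_grading D p \<in> invs"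
  unfolding invs_iff by (metis part_act part_polys)

lemma hilb_generators: "{p \<in> invs. \<exists>d>0. homogeneous std_grading d p} \<subseteq> polys Basis"
  by (auto simp: invs_polys)

lemma ideal_hilb: "ideal hilb (mpoly_ring Basis)"
  unfolding hilbert_ideal_def by (intro ideal_Idl_polys hilb_generators)

lemma invariant_in_hilb: "p \<in> invs \<Longrightarrow> homogeneous std_grading d p \<Longrightarrow> 0 < d \<Longrightarrow> p \<in> hilb"
  unfolding hilbert_ideal_def using Idl_polys_superset[OF hilb_generators] by blast

end

locale nonmodular_representation = finite_dim_representation G scale Basis \<rho>
  for G :: "('g, 'm) monoid_scheme" (structure)
    and scale :: "'k::field \<Rightarrow> 'v::ab_group_add \<Rightarrow> 'v"
    and Basis :: "'v set"
    and \<rho> :: "'g \<Rightarrow> 'v \<Rightarrow> 'v" +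
  assumes finite_G: "finite (carrier G)"
    and nonmodular: "\<not> CHAR('k) dvd order G"
begin

lemma order_neq_0: "(of_nat (order G) :: 'k) \<noteq> 0"
  using nonmodular by (simp add: of_nat_eq_0_iff_char_dvd)

lemma sum_act_invariant:
  assumes p: "p \<in> polys Basis"
  shows "(\<Sum>g\<in>carrier G. act g p) \<in> invs"
  unfolding invs_iff
proof (intro conjI ballI)
  show "(\<Sum>g\<in>carrier G. act g p) \<in> polys Basis"
    using p by simp
  fix h assume h: "h \<in> carrier G"
  have "act h (\<Sum>g\<in>carrier G. act g p) = (\<Sum>g\<in>carrier G. act (h \<otimes> g) p)"
    unfolding act_sum using p h by (intro sum.cong) (simp_all add: act_act)
  also have "\<dots> = (\<Sum>g\<in>carrier G. act g p)"
    using h by (intro sum.reindex_bij_witness[of _ "\<lambda>g. inv h \<otimes> g" "\<lambda>g. h \<otimes> g"])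
      (simp_all add: m_assoc[symmetric])
  finally show "act h (\<Sum>g\<in>carrier G. act g p) = (\<Sum>g\<in>carrier G. act g p)" .
qed

definition reynolds :: "('v, 'k) mpoly \<Rightarrow> ('v, 'k) mpoly"
  where "reynolds p = Const (inverse (of_nat (order G))) * (\<Sum>g\<in>carrier G. act g p)"

lemma reynolds_invariant: "p \<in> polys Basis \<Longrightarrow> reynolds p \<in> invs"
  unfolding reynolds_def by (intro invs_mult invs_Const sum_act_invariant)

lemma reynolds_0 [simp]: "reynolds 0 = 0"
  by (simp add: reynolds_def)

lemma reynolds_add: "reynolds (p + q) = reynolds p + reynolds q"
  by (simp add: reynolds_def sum.distrib distrib_left)

lemma reynolds_uminus: "reynolds (- p) = - reynolds p"
  by (simp add: reynolds_def sum_negf)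

lemma reynolds_sum: "reynolds (sum p A) = (\<Sum>i\<in>A. reynolds (p i))"
  by (induction A rule: infinite_finite_induct) (auto simp: reynolds_add)

text \<open>
  Linearity over the invariants is what makes the coefficients of an identity
  \<open>p = \<Sum> c\<^sub>i f\<^sub>i\<close> between invariants invariant as well.
\<close>
lemma reynolds_mult_invariant: "f \<in> invs \<Longrightarrow> reynolds (p * f) = reynolds p * f"
  by (simp add: reynolds_def invs_iff sum_distrib_right mult.assoc)

lemma reynolds_of_invariant:
  assumes "f \<in> invs"
  shows "reynolds f = f"
proof -
  have "reynolds f = Const (inverse (of_nat (order G))) * Const (of_nat (order G)) * f"
    using assms by (simp add: reynolds_def invs_iff order_def Const_of_nat mult.assoc)
  then show ?thesis
    by (simp add: Const_mult_Const_inverse order_neq_0)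
qed

lemma reynolds_homogeneous:
  assumes "p \<in> polys Basis" "homogeneous std_grading d p"
  shows "homogeneous std_grading d (reynolds p)"
  using homogeneous_mult[OF homogeneous_Const homogeneous_sum[OF act_homogeneous[OF assms]]]
  by (simp add: reynolds_def)

section \<open>Polynomials of degree at least the group order\<close>

text \<open>
  Put \<open>z\<^sub>g = - g y\<^sub>g\<close>. For each \<open>h\<close> the product \<open>\<Prod>\<^sub>g (h z\<^sub>g + y\<^sub>g)\<close> vanishes, since its factor at
  \<open>g = h\<inverse>\<close> is zero. Sum over \<open>h\<close> and expand: the subset \<open>A \<subseteq> G\<close> of the indices at which
  \<open>h z\<^sub>g\<close> is picked contributes \<open>(\<Sum>\<^sub>h h (\<Prod>\<^sub>A z)) \<Prod>\<^bsub>G - A\<^esub> y\<close>. The first factor is an invariant of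
  degree \<open>|A|\<close>, so the term is in the Hilbert ideal if \<open>A\<close> is nonempty, while the empty set gives
  \<open>|G| \<Prod>\<^sub>g y\<^sub>g\<close> and \<open>|G|\<close> is invertible.
\<close>
lemma prod_linear_forms_in_hilb:
  assumes y: "\<And>g. g \<in> carrier G \<Longrightarrow> y g \<in> polys Basis"
    "\<And>g. g \<in> carrier G \<Longrightarrow> homogeneous std_grading 1 (y g)"
  shows "(\<Prod>g\<in>carrier G. y g) \<in> hilb"
proof -
  let ?G = "carrier G"
  define z where "z g = - act g (y g)" for g
  define s where "s A = (\<Sum>h\<in>?G. act h (prod z A)) * prod y (?G - A)" for A
  have z: "z g \<in> polys Basis" "homogeneous std_grading 1 (z g)" if "g \<in> ?G" for g
    using act_homogeneous[OF y(1) y(2)] y that by (simp_all add: z_def)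
  have "(\<Prod>g\<in>?G. act h (z g) + y g) = 0" if h: "h \<in> ?G" for h
  proof (rule prod_zero[OF finite_G bexI[of _ "inv h"]])
    show "act h (z (inv h)) + y (inv h) = 0"
      using h y by (simp add: z_def act_act act_one)
  qed (use h in simp)
  then have "0 = (\<Sum>h\<in>?G. \<Prod>g\<in>?G. act h (z g) + y g)"
    by simp
  also have "\<dots> = (\<Sum>A\<in>Pow ?G. s A)"
    unfolding prod_add[OF finite_G] s_def act_prod sum_distrib_right by (rule sum.swap)
  also have "\<dots> = s {} + (\<Sum>A\<in>Pow ?G - {{}}. s A)"
    using finite_G by (intro sum.remove) auto
  also have "s {} = Const (of_nat (order G)) * prod y ?G"
    by (simp add: s_def order_def Const_of_nat)
  finally have eq: "Const (of_nat (order G)) * prod y ?G = - (\<Sum>A\<in>Pow ?G - {{}}. s A)"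
    by (simp add: eq_neg_iff_add_eq_0)
  have "s A \<in> hilb" if A: "A \<in> Pow ?G - {{}}" for A
  proof -
    have "finite A" "A \<noteq> {}"
      using A finite_G finite_subset by auto
    moreover have "homogeneous std_grading (sum (\<lambda>_. 1) A) (prod z A)"
      using A z by (intro homogeneous_prod) auto
    moreover have zA: "prod z A \<in> polys Basis"
      using A z by (intro polys_prod) auto
    ultimately have "(\<Sum>h\<in>?G. act h (prod z A)) \<in> hilb"
      by (intro invariant_in_hilb[of _ "card A"] sum_act_invariant homogeneous_sum act_homogeneous)
        (simp_all add: card_gt_0_iff)
    then show ?thesis
      unfolding s_def mult.commute[of _ "prod y _"]
      using y by (intro ideal_polysD(4)[OF ideal_hilb] polys_prod) auto
  qed
  then have "(\<Sum>A\<in>Pow ?G - {{}}. s A) \<in> hilb"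
    by (rule ideal_polys_sum[OF ideal_hilb])
  then have "Const (- inverse (of_nat (order G))) * (\<Sum>A\<in>Pow ?G - {{}}. s A) \<in> hilb"
    by (intro ideal_polysD(4)[OF ideal_hilb]) auto
  also have "Const (- inverse (of_nat (order G))) * (\<Sum>A\<in>Pow ?G - {{}}. s A) =
      Const (inverse (of_nat (order G))) * (Const (of_nat (order G)) * prod y ?G)"
    by (simp add: eq Const_uminus)
  also have "\<dots> = prod y ?G"
    by (simp add: Const_mult_Const_inverse order_neq_0 flip: mult.assoc)
  finally show ?thesis .
qed

text \<open>
  A monomial of degree at least \<open>|G|\<close> is a multiple of a product of \<open>|G|\<close> variables. To avoid
  indexing the variables of a monomial by group elements, the variables are split off one after
  the other: for \<open>A \<subseteq> G\<close>, the claim holds for \<open>q \<Prod>\<^bsub>G - A\<^esub> y\<close> with \<open>q\<close> of order at least \<open>|A|\<close>.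
\<close>
lemma order_ge_order_in_hilb:
  assumes "p \<in> polys Basis" "order_ge (order G) p"
  shows "p \<in> hilb"
proof -
  have key: "q * (\<Prod>g\<in>carrier G - A. Var (y g)) \<in> hilb"
    if "finite A" "A \<subseteq> carrier G" "q \<in> polys Basis" "order_ge (card A) q" "\<forall>g\<in>carrier G. y g \<in> Basis"
    for A q y
    using that
  proof (induction A arbitrary: q y rule: finite_induct)
    case empty
    then have "(\<Prod>g\<in>carrier G. Var (y g)) \<in> hilb"
      by (intro prod_linear_forms_in_hilb homogeneous_Var) auto
    then show ?case
      using empty by (simp add: ideal_polysD(4)[OF ideal_hilb])
  next
    case (insert a A)
    have "order_ge (Suc (card A)) q"
      using insert.prems insert.hyps by simp
    then obtain u where u: "\<forall>x. u x \<in> polys Basis \<and> order_ge (card A) (u x)"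
      "q = (\<Sum>x\<in>Basis. Var x * u x)"
      using order_ge_polynomial_decomposition[OF finite_Basis] insert.prems by blast
    have "Var x * u x * (\<Prod>g\<in>carrier G - insert a A. Var (y g)) \<in> hilb" if x: "x \<in> Basis" for x
    proof -
      have "carrier G - A - {a} = carrier G - insert a A" "a \<in> carrier G - A"
        using insert.prems insert.hyps by auto
      then have "(\<Prod>g\<in>carrier G - A. Var ((y(a := x)) g)) =
          Var x * (\<Prod>g\<in>carrier G - insert a A. Var ((y(a := x)) g) :: ('v, 'k) mpoly)"
        using prod.remove[of "carrier G - A" a "\<lambda>g. Var ((y(a := x)) g)"] finite_G by simp
      also have "(\<Prod>g\<in>carrier G - insert a A. Var ((y(a := x)) g) :: ('v, 'k) mpoly) =
          (\<Prod>g\<in>carrier G - insert a A. Var (y g))"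
        by (intro prod.cong) auto
      finally show ?thesis
        using insert.IH[of "u x" "y(a := x)"] u(1) insert.prems x
        by (simp add: mult.assoc mult.left_commute)
    qed
    then show ?case
      unfolding u(2) sum_distrib_right by (rule ideal_polys_sum[OF ideal_hilb])
  qed
  show ?thesis
    \<comment> \<open>Without variables there is no family \<open>y\<close>, but then the only polynomial of positive order is
      zero.\<close>
  proof (cases "Basis = {}")
    case True
    have "0 < order G"
      using finite_G by (simp add: order_gt_0_iff_finite)
    then have "order_ge (Suc 0) p"
      using assms(2) order_ge_mono by (metis Suc_leI)
    then have "p = 0"
      using order_ge_polynomial_decomposition[OF finite_Basis assms(1)] True by force
    then show ?thesis
      using ideal_polysD(2)[OF ideal_hilb] by simp
  next
    case False
    then obtain b where "b \<in> Basis" by blast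
    then show ?thesis
      using key[OF finite_G order.refl assms(1), of "\<lambda>_. b"] assms(2) by (simp add: order_def)
  qed
qed

abbreviation "\<tau> \<equiv> tau G scale Basis \<rho>"

lemma tau_le_order: "\<tau> \<le> order G"
  unfolding tau_def
  by (rule Least_le) (blast intro: order_ge_order_in_hilb order_ge_homogeneous)

text \<open>
  The minimum in the definition of \<open>\<tau>\<close> is attained because the group order is a candidate.
\<close>
lemma order_ge_tau_in_hilb:
  assumes "p \<in> polys Basis" "order_ge \<tau> p"
  shows "p \<in> hilb"
proof (rule ideal_contains_order_ge[OF ideal_hilb finite_Basis _ assms])
  have "\<forall>p\<in>polys Basis. homogeneous std_grading \<tau> p \<longrightarrow> p \<in> hilb"
    unfolding tau_def
    by (rule LeastI[of _ "order G"]) (blast intro: order_ge_order_in_hilb order_ge_homogeneous)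
  then show "p \<in> hilb" if "p \<in> polys Basis" "homogeneous std_grading \<tau> p" for p
    using that by blast
qed

end

section \<open>Degrees of the generators\<close>

lemma generate_ring_eq_image_eval:
  assumes f: "\<And>i. i \<in> A \<Longrightarrow> f i \<in> polys X"
  shows "generate_ring (mpoly_ring X) (range Const \<union> f ` A) = eval_mpoly f ` polys A"
    (is "?L = ?R")
proof
  interpret cring "mpoly_ring X" by (rule cring_mpoly_ring)
  have R: "?R \<subseteq> polys X"
    using f by (intro image_subsetI eval_mpoly_polys)
  show "?L \<subseteq> ?R"
  proof
    fix p assume "p \<in> ?L"
    then show "p \<in> ?R"
    proof induction
      case one
      show ?case by (rule image_eqI[of _ _ 1]) simp_all
    next
      case (incl p)
      then consider c where "p = Const c" | i where "i \<in> A" "p = f i" by blast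
      then show ?case
      proof cases
        case (1 c)
        then show ?thesis by (intro image_eqI[of _ _ "Const c"]) simp_all
      next
        case (2 i)
        then show ?thesis by (intro image_eqI[of _ _ "Var i"]) simp_all
      qed
    next
      case (a_inv p)
      then obtain h where h: "h \<in> polys A" "p = eval_mpoly f h" by blast
      have "\<ominus>\<^bsub>mpoly_ring X\<^esub> p = - p"
        using a_inv.IH R by (intro minus_equality) auto
      then show ?case
        using h by (intro image_eqI[of _ _ "- h"]) simp_all
    next
      case (eng_add p q)
      then obtain h k where "h \<in> polys A" "p = eval_mpoly f h" "k \<in> polys A" "q = eval_mpoly f k" by blast
      then show ?case
        by (intro image_eqI[of _ _ "h + k"]) simp_all
    next
      case (eng_mult p q)
      then obtain h k where "h \<in> polys A" "p = eval_mpoly f h" "k \<in> polys A" "q = eval_mpoly f k" by blast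
      then show ?case
        by (intro image_eqI[of _ _ "h * k"]) simp_all
    qed
  qed
  have "eval_mpoly f h \<in> ?L" if "h \<in> polys A" for h
    using that
  proof (induction rule: polys_induct)
    case (Const c)
    show ?case by (simp add: generate_ring.incl)
  next
    case (Var i)
    then show ?case by (simp add: generate_ring.incl)
  next
    case (add p q)
    then show ?case using generate_ring.eng_add[of _ "mpoly_ring X" "range Const \<union> f ` A"] by simp
  next
    case (mult p q)
    then show ?case using generate_ring.eng_mult[of _ "mpoly_ring X" "range Const \<union> f ` A"] by simp
  qed
  then show "?R \<subseteq> ?L"
    by blast
qed

lemma mpoly_degree_homogeneous:
  assumes "homogeneous w e p" "p \<noteq> 0"
  shows "mpoly_degree w p = e"
proof -
  have "monom_degree w ` Poly_Mapping.keys p = {e}"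
  proof
    obtain m where "m \<in> Poly_Mapping.keys p"
      using assms(2) by (auto simp: poly_mapping_eq_iff in_keys_iff fun_eq_iff)
    with assms(1) show "{e} \<subseteq> monom_degree w ` Poly_Mapping.keys p"
      by (auto simp: homogeneous_def)
  qed (use assms(1) in \<open>auto simp: homogeneous_def\<close>)
  then show ?thesis
    by (simp add: mpoly_degree_def)
qed

lemma homogeneous_0_imp_Const:
  fixes p :: "('x, 'k::field) mpoly"
  assumes "homogeneous std_grading 0 p"
  shows "p = Const (Poly_Mapping.lookup p 0)"
proof -
  have "m = 0" if m: "m \<in> Poly_Mapping.keys p" for m
  proof (rule poly_mapping_eqI)
    fix x
    have "(\<Sum>x\<in>Poly_Mapping.keys m. Poly_Mapping.lookup m x) = 0"
      using assms m by (simp add: homogeneous_def monom_degree_def)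
    then show "Poly_Mapping.lookup m x = Poly_Mapping.lookup 0 x"
      by (auto simp: in_keys_iff)
  qed
  then show ?thesis
    using poly_mapping_sum_monomials[of "{0}" p] by (auto simp: Const_def)
qed

lemma part_empty [simp]: "part w {} p = 0"
  by (rule part_eq_0) simp

locale minimal_generators = nonmodular_representation G scale Basis \<rho>
  for G :: "('g, 'm) monoid_scheme" (structure)
    and scale :: "'k::field \<Rightarrow> 'v::ab_group_add \<Rightarrow> 'v"
    and Basis :: "'v set"
    and \<rho> :: "'g \<Rightarrow> 'v \<Rightarrow> 'v" +
  fixes r :: nat and f :: "nat \<Rightarrow> ('v, 'k) mpoly"
  assumes inj_f: "inj_on f {1..r}"
    and minimal: "minimal_homogeneous_generators Basis (f ` {1..r}) (invariants G scale Basis \<rho>)"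
begin

abbreviation deg :: "nat \<Rightarrow> nat"
  where "deg i \<equiv> mpoly_degree std_grading (f i)"

lemma generate_ring_eq_invs: "generate_ring (mpoly_ring Basis) (range Const \<union> f ` {1..r}) = invs"
  using minimal unfolding minimal_homogeneous_generators_def generates_algebra_def by (elim conjE)

lemma f_invs: "i \<in> {1..r} \<Longrightarrow> f i \<in> invs"
  unfolding generate_ring_eq_invs[symmetric] by (intro generate_ring.incl UnI2 imageI)

lemma f_polys: "i \<in> {1..r} \<Longrightarrow> f i \<in> polys Basis"
  by (rule invs_polys[OF f_invs])

lemma invs_eq_image_eval: "invs = eval_mpoly f ` polys {1..r}"
  using generate_ring_eq_image_eval[of "{1..r}" f Basis, OF f_polys] generate_ring_eq_invs by simp

text \<open>
  The degree of the zero polynomial is \<open>0\<close> by convention, so until minimality is used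
  (\<open>low_eq\<close>), a zero generator has to be admitted.
\<close>
lemma f_homogeneous_pos:
  assumes "i \<in> {1..r}"
  shows "f i = 0 \<or> homogeneous std_grading (deg i) (f i) \<and> 0 < deg i"
proof -
  have "\<forall>p\<in>f ` {1..r}. \<exists>d>0. homogeneous std_grading d p"
    using minimal unfolding minimal_homogeneous_generators_def by (elim conjE)
  then obtain e where "0 < e" "homogeneous std_grading e (f i)"
    using assms by blast
  then show ?thesis
    using mpoly_degree_homogeneous[of std_grading e "f i"] by blast
qed

lemma f_homogeneous: "i \<in> {1..r} \<Longrightarrow> homogeneous std_grading (deg i) (f i)"
  using f_homogeneous_pos homogeneous_0 by metis

lemma part_combination:
  assumes "A \<subseteq> {1..r}"
  shows "part std_grading {e} (\<Sum>i\<in>A. c i * f i) = (\<Sum>i\<in>A. part std_grading {n. n + deg i = e} (c i) * f i)"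
  unfolding part_sum
proof (rule sum.cong[OF refl])
  fix i assume "i \<in> A"
  then have "homogeneous std_grading (deg i) (f i)"
    using assms f_homogeneous by blast
  from part_mult_homogeneous[OF this, of "{e}" "c i"]
  show "part std_grading {e} (c i * f i) = part std_grading {n. n + deg i = e} (c i) * f i"
    by simp
qed

text \<open>
  A polynomial in the \<open>f\<^sub>i\<close> is a constant plus a combination of the \<open>f\<^sub>i\<close>, and the constant
  disappears in positive degree.
\<close>
lemma hilb_subset_combinations: "hilb \<subseteq> combinations Basis {1..r} f"
  unfolding hilbert_ideal_def
proof (intro Idl_polys_minimal ideal_combinations f_polys subsetI)
  fix p assume "p \<in> {p \<in> invs. \<exists>d>0. homogeneous std_grading d p}"
  then obtain e where p: "p \<in> invs" "0 < e" "homogeneous std_grading e p"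
    by blast
  obtain h where h: "h \<in> polys {1..r}" "p = eval_mpoly f h"
    using p(1) invs_eq_image_eval by blast
  obtain c u where u: "\<forall>i. u i \<in> polys {1..r}" "h = Const c + (\<Sum>i\<in>{1..r}. Var i * u i)"
    using polynomial_decomposition[OF _ h(1)] by auto
  have "p = part std_grading {e} p"
    using p(3) by (simp add: homogeneous_iff_degrees_in part_eq_self)
  also have "\<dots> = part std_grading {e} (\<Sum>i\<in>{1..r}. eval_mpoly f (u i) * f i)"
    using p(2) by (simp add: h(2) u(2) part_add part_Const_eq_0 mult.commute)
  also have "\<dots> = (\<Sum>i\<in>{1..r}. part std_grading {n. n + deg i = e} (eval_mpoly f (u i)) * f i)"
    by (rule part_combination) simp
  finally have "p = (\<Sum>i\<in>{1..r}. part std_grading {n. n + deg i = e} (eval_mpoly f (u i)) * f i)" .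
  moreover have "part std_grading {n. n + deg i = e} (eval_mpoly f (u i)) \<in> polys Basis" for i
    by (rule part_polys, rule eval_mpoly_polys[OF u(1)[rule_format] f_polys])
  ultimately show "p \<in> combinations Basis {1..r} f"
    unfolding combinations_def
    by (intro CollectI exI[of _ "\<lambda>i. part std_grading {n. n + deg i = e} (eval_mpoly f (u i))"]) blast
qed

text \<open>
  Indices of degree \<open>0\<close> belong to zero generators. Leaving them out makes the coefficient of \<open>f i\<close>
  in a homogeneous invariant have strictly smaller degree than the invariant.
\<close>
definition low :: "nat set"
  where "low = {i \<in> {1..r}. 0 < deg i \<and> deg i \<le> \<tau>}"

lemma low_subset: "low \<subseteq> {1..r}" and finite_low: "finite low"
  by (auto simp: low_def)

lemma ideal_low: "ideal (combinations Basis low f) (mpoly_ring Basis)"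
  using low_subset by (intro ideal_combinations f_polys) auto

lemma hilb_low_degree:
  assumes p: "p \<in> hilb" "homogeneous std_grading e p" and e: "e \<le> \<tau>"
  shows "p \<in> combinations Basis low f"
proof -
  obtain c where c: "\<forall>i. c i \<in> polys Basis" "p = (\<Sum>i\<in>{1..r}. c i * f i)"
    using p(1) hilb_subset_combinations by (auto simp: combinations_def)
  define c' where "c' i = part std_grading {n. n + deg i = e} (c i)" for i
  have "p = part std_grading {e} p"
    using p(2) by (simp add: homogeneous_iff_degrees_in part_eq_self)
  also have "\<dots> = (\<Sum>i\<in>{1..r}. c' i * f i)"
    unfolding c(2) c'_def by (rule part_combination) simp
  also have "\<dots> = (\<Sum>i\<in>low. c' i * f i)"
  proof (rule sum.mono_neutral_right)
    show "\<forall>i\<in>{1..r} - low. c' i * f i = 0"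
    proof
      fix i assume i: "i \<in> {1..r} - low"
      show "c' i * f i = 0"
      proof (cases "f i = 0")
        case False
        then have "\<tau> < deg i"
          using i f_homogeneous_pos[of i] by (auto simp: low_def)
        then have "{n. n + deg i = e} = {}"
          using e by auto
        then show ?thesis
          by (simp add: c'_def)
      qed simp
    qed
  qed (auto simp: low_def)
  finally show ?thesis
    unfolding combinations_def using c(1) by (auto simp: c'_def)
qed

lemma order_ge_tau_in_low:
  assumes "p \<in> polys Basis" "order_ge \<tau> p"
  shows "p \<in> combinations Basis low f"
proof (rule ideal_contains_order_ge[OF ideal_low finite_Basis _ assms])
  fix q :: "('v, 'k) mpoly"
  assume "q \<in> polys Basis" "homogeneous std_grading \<tau> q"
  then show "q \<in> combinations Basis low f"
    by (intro hilb_low_degree[of q \<tau>] order_ge_tau_in_hilb order_ge_homogeneous) auto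
qed

text \<open>
  Hilbert's argument: \<open>p\<close> is a combination of generators of low degree; apply the Reynolds operator
  to make the coefficients invariant, and use induction on them, since they have smaller degree.
\<close>
lemma homogeneous_invariant_in_low_algebra:
  assumes "p \<in> invs" "homogeneous std_grading e p"
  shows "p \<in> eval_mpoly f ` polys low"
  using assms
proof (induction e arbitrary: p rule: less_induct)
  case (less e)
  show ?case
  proof (cases "e = 0")
    case True
    then have "p = Const (Poly_Mapping.lookup p 0)"
      using less.prems homogeneous_0_imp_Const by blast
    then show ?thesis
      by (metis eval_mpoly_Const image_eqI polys_Const)
  next
    case False
    then have hilb: "p \<in> hilb"
      using less.prems by (intro invariant_in_hilb) auto
    \<comment> \<open>In degree at most \<open>\<tau>\<close> no other generator can contribute for degree reasons; in degree at
      least \<open>\<tau>\<close> the polynomial is a combination of forms of degree \<open>\<tau>\<close>.\<close>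
    have "p \<in> combinations Basis low f"
    proof (cases "e \<le> \<tau>")
      case True
      then show ?thesis using hilb less.prems by (intro hilb_low_degree) auto
    next
      case False
      then have "order_ge \<tau> p"
        using order_ge_mono[OF order_ge_homogeneous[OF less.prems(2)]] by simp
      then show ?thesis
        using order_ge_tau_in_low less.prems invs_polys by blast
    qed
    then obtain c where c: "\<forall>i. c i \<in> polys Basis" "p = (\<Sum>i\<in>low. c i * f i)"
      by (auto simp: combinations_def)
    define c' where "c' i = part std_grading {n. n + deg i = e} (c i)" for i
    have "p = part std_grading {e} p"
      using less.prems(2) by (simp add: homogeneous_iff_degrees_in part_eq_self)
    also have "\<dots> = (\<Sum>i\<in>low. c' i * f i)"
      unfolding c(2) c'_def by (rule part_combination[OF low_subset])
    finally have p: "p = (\<Sum>i\<in>low. c' i * f i)" .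
    have "p = reynolds p"
      using less.prems by (simp add: reynolds_of_invariant)
    also have "\<dots> = (\<Sum>i\<in>low. reynolds (c' i) * f i)"
      unfolding p reynolds_sum using low_subset
      by (intro sum.cong refl reynolds_mult_invariant f_invs) auto
    finally have p_reynolds: "p = (\<Sum>i\<in>low. reynolds (c' i) * f i)" .
    have "\<forall>i\<in>low. \<exists>h. h \<in> polys low \<and> reynolds (c' i) = eval_mpoly f h"
    proof
      fix i assume i: "i \<in> low"
      have c'_polys: "c' i \<in> polys Basis"
        using c(1) by (simp add: c'_def)
      have "homogeneous std_grading (e - deg i) (c' i)"
        unfolding c'_def homogeneous_iff_degrees_in
        by (rule degrees_in_mono[OF degrees_in_part]) auto
      moreover have "e - deg i < e"
        using i False by (simp add: low_def)
      ultimately have "reynolds (c' i) \<in> eval_mpoly f ` polys low"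
        using less.IH reynolds_invariant[OF c'_polys] reynolds_homogeneous[OF c'_polys] by blast
      then show "\<exists>h. h \<in> polys low \<and> reynolds (c' i) = eval_mpoly f h"
        by blast
    qed
    from bchoice[OF this] obtain h where
      h: "\<forall>i\<in>low. h i \<in> polys low \<and> reynolds (c' i) = eval_mpoly f (h i)"
      by blast
    have "p = eval_mpoly f (\<Sum>i\<in>low. h i * Var i)"
      using h by (subst p_reynolds) simp
    moreover have "(\<Sum>i\<in>low. h i * Var i) \<in> polys low"
      using h by simp
    ultimately show ?thesis
      by blast
  qed
qed

lemma low_algebra_eq_invs: "eval_mpoly f ` polys low = invs"
proof
  show "eval_mpoly f ` polys low \<subseteq> invs"
    using polys_mono[OF _ low_subset] unfolding invs_eq_image_eval by blast
  show "invs \<subseteq> eval_mpoly f ` polys low"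
  proof
    fix p assume p: "p \<in> invs"
    have "\<forall>e. \<exists>h. h \<in> polys low \<and> part std_grading {e} p = eval_mpoly f h"
      using homogeneous_invariant_in_low_algebra[OF invs_part[OF p] homogeneous_part] by blast
    then obtain h where h: "\<And>e. h e \<in> polys low" "\<And>e. part std_grading {e} p = eval_mpoly f (h e)"
      by metis
    let ?D = "monom_degree std_grading ` Poly_Mapping.keys p"
    have "p = (\<Sum>e\<in>?D. part std_grading {e} p)"
      by (rule homogeneous_decomposition)
    also have "\<dots> = eval_mpoly f (\<Sum>e\<in>?D. h e)"
      by (simp only: h(2) eval_mpoly_sum)
    finally show "p \<in> eval_mpoly f ` polys low"
      using h(1) by (intro image_eqI[of _ _ "\<Sum>e\<in>?D. h e"] polys_sum)
  qed
qed

text \<open>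
  By minimality, the generators of low degree are all generators, and since \<open>f\<close> is injective this
  carries over to the indices.
\<close>
lemma low_eq: "low = {1..r}"
proof (rule ccontr)
  assume "low \<noteq> {1..r}"
  then have "f ` low \<subset> f ` {1..r}"
    using low_subset inj_f by (metis image_mono inj_on_image_eq_iff order.refl psubsetI)
  moreover have "generates_algebra Basis (f ` low) invs"
    unfolding generates_algebra_def using low_subset f_polys
    by (subst generate_ring_eq_image_eval) (auto simp: low_algebra_eq_invs)
  moreover have "\<forall>T. T \<subset> f ` {1..r} \<longrightarrow> \<not> generates_algebra Basis T invs"
    using minimal unfolding minimal_homogeneous_generators_def by (elim conjE)
  ultimately show False
    by blast
qed

lemma deg_pos: "i \<in> {1..r} \<Longrightarrow> 0 < deg i" and deg_le_tau: "i \<in> {1..r} \<Longrightarrow> deg i \<le> \<tau>"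
  unfolding low_eq[symmetric] by (simp_all add: low_def)

section \<open>Relations among the generators\<close>

sublocale high: ideal_of_high_degrees Basis "{1..r}" f deg \<tau>
  using order_ge_tau_in_low[unfolded low_eq]
  by unfold_locales (simp_all only: finite_Basis finite_atLeastAtMost f_polys f_homogeneous deg_le_tau)

lemma ideal_syzygy_ideal: "ideal (syzygy_ideal r f) (mpoly_ring {1..r})"
  by (rule ideal_polysI) (auto simp: syzygy_ideal_def)

lemma syzygy_ideal_part:
  assumes h: "h \<in> syzygy_ideal r f"
  shows "part deg D h \<in> syzygy_ideal r f"
proof -
  have h_polys: "h \<in> polys {1..r}" and h_eval: "eval_mpoly f h = 0"
    using h by (simp_all add: syzygy_ideal_def)
  have "part std_grading D (eval_mpoly f h) = eval_mpoly f (part deg D h)"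
    by (rule part_eval_mpoly[where X = "{1..r}"]) (rule h_polys, erule f_homogeneous)
  then have "eval_mpoly f (part deg D h) = 0"
    by (simp only: h_eval part_0)
  with part_polys[OF h_polys] show ?thesis
    by (simp add: syzygy_ideal_def)
qed

text \<open>
  The step from Koszul syzygies back to relations: a relation of degree above \<open>2\<tau>\<close> is a
  combination of relations of smaller degree, by subtracting from its coefficients an alternating
  combination of the variables.
\<close>
lemma syzygy_ideal_high_degree:
  assumes h: "h \<in> syzygy_ideal r f" "homogeneous deg e h" and e: "2 * \<tau> < e"
  shows "\<exists>v. (\<forall>i\<in>{1..r}. v i \<in> syzygy_ideal r f \<and> homogeneous deg (e - deg i) (v i)) \<and>
    h = (\<Sum>i\<in>{1..r}. Var i * v i)"
proof -
  let ?I = "{1..r}"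
  have part_h: "part deg {e} h = h"
    using h(2) by (simp add: homogeneous_iff_degrees_in part_eq_self)
  obtain u where u: "\<And>i. u i \<in> polys ?I" "\<And>i. degrees_in deg {n. n + deg i \<in> {e}} (u i)"
      "h = (\<Sum>i\<in>?I. Var i * u i)"
    using part_polynomial_decomposition[of ?I h "{e}" deg] h(1) e
    unfolding part_h by (auto simp: syzygy_ideal_def)
  define w where "w i = eval_mpoly f (u i)" for i
  have w_invs: "w i \<in> invs" for i
    using u(1) by (auto simp: w_def invs_eq_image_eval)
  have "high.syzygy (2 * \<tau> + 1) w"
    unfolding high.syzygy_def
  proof (intro conjI ballI)
    fix i
    show "w i \<in> polys Basis"
      by (rule invs_polys[OF w_invs])
    have "degrees_in std_grading {n. n + deg i \<in> {e}} (w i)"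
      unfolding w_def by (rule degrees_in_eval_mpoly[OF u(1,2) f_homogeneous])
    then show "order_ge (2 * \<tau> + 1 - deg i) (w i)"
      unfolding order_ge_def by (rule degrees_in_mono) (use e in auto)
    have "(\<Sum>i\<in>?I. w i * f i) = eval_mpoly f h"
      by (simp add: u(3) w_def mult.commute)
    then show "(\<Sum>i\<in>?I. w i * f i) = 0"
      using h(1) by (simp add: syzygy_ideal_def)
  qed
  then obtain a where a: "alternating a" "\<And>i j. a i j \<in> polys Basis"
      "\<And>i. i \<in> ?I \<Longrightarrow> w i = (\<Sum>j\<in>?I. a i j * f j)"
    using high.syzygy_imp_koszul unfolding high.koszul_def by blast
  have w_reynolds: "w i = (\<Sum>j\<in>?I. reynolds (a i j) * f j)" if i: "i \<in> ?I" for i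
  proof -
    have "w i = reynolds (\<Sum>j\<in>?I. a i j * f j)"
      using reynolds_of_invariant[OF w_invs] a(3)[OF i] by metis
    then show ?thesis
      unfolding reynolds_sum by (simp add: reynolds_mult_invariant f_invs)
  qed
  have reynolds_alternating: "alternating (\<lambda>i j. reynolds (a i j))"
  proof (rule alternatingI)
    show "reynolds (a i i) = 0" for i
      by (simp add: alternating_diag[OF a(1)])
    show "reynolds (a i j) = - reynolds (a j i)" for i j
      by (simp add: alternating_swap[OF a(1), of i j] reynolds_uminus)
  qed
  \<comment> \<open>Each entry has a single polynomial as preimage, so the index type in \<open>alternating_lift\<close> is
    the unit type.\<close>
  have lift: "\<exists>c. c () \<in> polys ?I \<and> eval_mpoly f (c ()) = reynolds (a i j)" for i j
    using reynolds_invariant[OF a(2), of i j] unfolding invs_eq_image_eval by auto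
  obtain b where b: "alternating (\<lambda>i j. b i j ())" "\<And>i j. i \<in> ?I \<Longrightarrow> j \<in> ?I \<Longrightarrow> b i j () \<in> polys ?I"
      "\<And>i j. i \<in> ?I \<Longrightarrow> j \<in> ?I \<Longrightarrow> eval_mpoly f (b i j ()) = reynolds (a i j)"
    using alternating_lift[OF _ reynolds_alternating, of ?I "\<lambda>c y. c () \<in> polys ?I \<and> eval_mpoly f (c ()) = y"] lift
    by auto
  \<comment> \<open>The \<open>u' i\<close> are relations with \<open>h = \<Sum> x\<^sub>i u' i\<close>; taking parts restores homogeneity.\<close>
  define u' where "u' i = u i - (\<Sum>j\<in>?I. b i j () * Var j)" for i
  define v where "v i = part deg {n. n + deg i \<in> {e}} (u' i)" for i
  have "(\<Sum>i\<in>?I. Var i * u' i) = (\<Sum>i\<in>?I. Var i * u i) - (\<Sum>i\<in>?I. Var i * (\<Sum>j\<in>?I. b i j () * Var j))"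
    by (simp only: u'_def right_diff_distrib sum_subtractf)
  also have "\<dots> = h"
    using alternating_sum_eq_0[OF b(1), where y = Var and A = ?I] by (simp only: u(3) diff_zero)
  finally have "h = part deg {e} (\<Sum>i\<in>?I. u' i * Var i)"
    by (simp only: part_h mult.commute)
  also have "\<dots> = (\<Sum>i\<in>?I. Var i * v i)"
    unfolding part_sum part_mult_Var v_def by (simp only: mult.commute)
  finally have "h = (\<Sum>i\<in>?I. Var i * v i)" .
  moreover have "v i \<in> syzygy_ideal r f" if i: "i \<in> ?I" for i
  proof -
    have u'_polys: "u' i \<in> polys ?I"
      unfolding u'_def using u(1) b(2)[OF i] by (intro polys_diff polys_sum polys_mult) auto
    have "eval_mpoly f (u' i) = 0"
      using w_reynolds[OF i] b(3)[OF i] by (simp add: u'_def w_def)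
    with u'_polys show ?thesis
      unfolding v_def by (intro syzygy_ideal_part) (simp add: syzygy_ideal_def)
  qed
  moreover have "homogeneous deg (e - deg i) (v i)" for i
    unfolding v_def homogeneous_iff_degrees_in
    by (rule degrees_in_mono[OF degrees_in_part]) auto
  ultimately show ?thesis
    by blast
qed

text \<open>
  The graded Nakayama argument, as an induction on the degree: all \<open>f i\<close> have positive degree, so
  the degree drops whenever a relation is written as a combination of others.
\<close>
lemma syzygy_ideal_generated: "generated_in_degree_at_most {1..r} deg (syzygy_ideal r f) (2 * \<tau>)"
proof -
  let ?I = "{1..r}" and ?J = "syzygy_ideal r f"
  define S where "S = {h \<in> ?J. \<exists>e \<le> 2 * \<tau>. homogeneous deg e h}"
  have S_polys: "S \<subseteq> polys ?I"
    by (auto simp: S_def syzygy_ideal_def)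
  let ?K = "Idl\<^bsub>mpoly_ring ?I\<^esub> S"
  have K: "ideal ?K (mpoly_ring ?I)"
    by (rule ideal_Idl_polys[OF S_polys])
  have hom: "h \<in> ?K" if "h \<in> ?J" "homogeneous deg e h" for h e
    using that
  proof (induction e arbitrary: h rule: less_induct)
    case (less e)
    show ?case
    proof (cases "e \<le> 2 * \<tau>")
      case True
      then have "h \<in> S"
        unfolding S_def using less.prems by blast
      then show ?thesis
        using Idl_polys_superset[OF S_polys] by blast
    next
      case False
      then have "2 * \<tau> < e"
        by simp
      from syzygy_ideal_high_degree[OF less.prems this] obtain v where
        v: "\<forall>i\<in>?I. v i \<in> ?J \<and> homogeneous deg (e - deg i) (v i)" "h = (\<Sum>i\<in>?I. Var i * v i)"
        by (elim exE conjE)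
      have "v i \<in> ?K" if i: "i \<in> ?I" for i
      proof (rule less.IH)
        show "e - deg i < e"
          using deg_pos[OF i] False by linarith
        show "v i \<in> ?J" "homogeneous deg (e - deg i) (v i)"
          using v(1) i by blast+
      qed
      then show ?thesis
        unfolding v(2) by (intro ideal_polys_sum[OF K] ideal_polysD(4)[OF K]) (simp_all only: polys_Var)
    qed
  qed
  have "?J = ?K"
  proof
    show "?K \<subseteq> ?J"
      by (rule Idl_polys_minimal[OF ideal_syzygy_ideal]) (auto simp: S_def)
    show "?J \<subseteq> ?K"
    proof
      fix h assume h: "h \<in> ?J"
      have "part deg {e} h \<in> ?K" for e
        by (rule hom[OF syzygy_ideal_part[OF h] homogeneous_part])
      then have "(\<Sum>e\<in>monom_degree deg ` Poly_Mapping.keys h. part deg {e} h) \<in> ?K"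
        by (intro ideal_polys_sum[OF K])
      then show "h \<in> ?K"
        by (simp only: homogeneous_decomposition[of h deg, symmetric])
    qed
  qed
  then show ?thesis
    unfolding generated_in_degree_at_most_def using S_polys S_def by blast
qed

end

theorem theorem2:
  fixes G :: "('g, 'm) monoid_scheme"
    and scale :: "'k::field \<Rightarrow> 'v::ab_group_add \<Rightarrow> 'v"
    and Basis :: "'v set"
    and \<rho> :: "'g \<Rightarrow> 'v \<Rightarrow> 'v"
    and r :: nat
    and f :: "nat \<Rightarrow> ('v, 'k) mpoly"
  assumes "finite_dim_representation G scale Basis \<rho>"
    and "finite (carrier G)"
    and "\<not> CHAR('k) dvd order G"
    and "inj_on f {1..r}"
    and "minimal_homogeneous_generators Basis (f ` {1..r}) (invariants G scale Basis \<rho>)"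
  shows "generated_in_degree_at_most {1..r} (\<lambda>i. mpoly_degree std_grading (f i))
           (syzygy_ideal r f) (2 * tau G scale Basis \<rho>) \<and>
         2 * tau G scale Basis \<rho> \<le> 2 * order G"
proof -
  interpret minimal_generators G scale Basis \<rho> r f
    by (intro minimal_generators.intro nonmodular_representation.intro
        nonmodular_representation_axioms.intro minimal_generators_axioms.intro assms)
  show ?thesis
    by (intro conjI syzygy_ideal_generated mult_le_mono2 tau_le_order)
qed

end
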